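(* Let $A=K\langle x_1,\dots,x_n\mid f_1,\dots,f_m\rangle$ be essentially regular and suppose $H(A)$ is geometric with geometric data $(E,\sigma)$. Let $E_1\subset E$ be the set of points whose first coordinate (the one corresponding to $x_0$) is nonzero, and for $p=(1:p_1:\cdots:p_n)\in E_1$ let $M_p = A/\big((x_1-p_1)A+\cdots+(x_n-p_n)A\big)$. Then an $A$-module $M$ is $1$-dimensional if and only if $M\cong M_p$ for some $p\in E_1$. Moreover, if $M_p$ and $M_q$ are $1$-dimensional simple modules of $A$ (with $p,q\in E_1$), then $M_p\cong M_q$ if and only if $p=q$.
   Context: $K$ is an algebraically closed field of characteristic zero and all algebras are $K$-algebras. An algebra $A=K\langle x_1,\dots,x_n\mid f_1,\dots,f_m\rangle$ is given by generators $x_i$, all of degree 1, and polynomial relations $f_j$. For a noncommutative polynomial $f$ of degree $\alpha$, its homogenization $\hat f$ is obtained by multiplying each monomial of degree $\beta\le\alpha$ occurring in $f$ by $x_0^{\alpha-\beta}$, where $x_0$ is a new central indeterminate. The homogenization $H(A)$ is the $K$-algebra on $x_0,x_1,\dots,x_n$ with relations $\hat f_1,\dots,\hat f_m$ and $x_0x_i-x_ix_0$ for all $i$; $A\cong H(A)/(x_0-1)H(A)$. A connected graded algebra $B$ is (Artin–Schelter) regular of dimension $d$ if it has finite global dimension $d$, finite Gelfand–Kirillov dimension, and is AS-Gorenstein, i.e. $\operatorname{Ext}_B^i(K_B,B)$ is $0$ for $i\ne d$ and $\cong {}_BK$ for $i=d$, where $K_B=B/B_+$ is the trivial module. $A$ is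 essentially regular of dimension $d$ if $H(A)$ is regular of dimension $d+1$. Standing assumption: when $A$ is essentially regular, $x_0$ is not a zero divisor in $H(A)$. Geometric algebras: let $H=T(V)/(R)$ be a homogeneous quadratic algebra, $V$ the span of the degree one generators and $R\subset V\otimes_K V$ the space of relations. An element $f=\sum\alpha_{ij}x_i\otimes x_j\in V\otimes V$ is evaluated at $p=(a_0:\cdots:a_n)$, $q=(b_0:\cdots:b_n)\in\mathbb P(V^* )$ by $f(p,q)=\sum\alpha_{ij}a_ib_j$, and $\mathcal V(R)=\{(p,q)\in\mathbb P(V^* )\times\mathbb P(V^* )\mid f(p,q)=0\ \forall f\in R\}$. $H$ is geometric, with geometric data $(E,\sigma)$, if there are a scheme $E\subset\mathbb P(V^* )$ and $\sigma\in\operatorname{Aut}(E)$ such that (G1) $\mathcal V(R)=\{(p,\sigma(p))\mid p\in E\}$ and (G2) $R=\{f\in V\otimes_K V\mid f(p,\sigma(p))=0\ \forall p\in E\}$. For $H=H(A)$, $V$ has basis $x_0,x_1,\dots,x_n$; points of $E_1$ are normalized to have first coordinate $1$. *)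

theory Defs
  imports
    "Jordan_Normal_Form.VS_Connect"
    "HOL-Algebra.QuotRing"
    "HOL-Library.Poly_Mapping"
    "HOL-Library.Extended_Nat"
    "HOL-Library.Extended_Real"
    "HOL-Library.Liminf_Limsup"
    "HOL-Computational_Algebra.Polynomial"
begin

section \<open>Right modules over a noncommutative ring\<close>

text \<open>
  The module locale of HOL-Algebra is restricted to commutative base rings. The record type is
  reused here; for a right module the term \<open>r \<odot>\<^bsub>M\<^esub> x\<close> stands for \<open>x r\<close>. The ring fields
  \<open>mult\<close> and \<open>one\<close> of a module record are never used. The notions \<open>LinearCombinations.module_hom\<close> and
  \<open>Module.submodule\<close> of the libraries do not depend on the side, so they serve for right and
  for left modules.
\<close>

locale right_module = R?: ring R + M?: abelian_group M
  for R :: "('a, 'c) ring_scheme" (structure) and M :: "('a, 'b, 'd) module_scheme" (structure) +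
  assumes rsmult_closed: "\<lbrakk>r \<in> carrier R; x \<in> carrier M\<rbrakk> \<Longrightarrow> r \<odot>\<^bsub>M\<^esub> x \<in> carrier M"
    and rsmult_l_distr: "\<lbrakk>r \<in> carrier R; s \<in> carrier R; x \<in> carrier M\<rbrakk>
      \<Longrightarrow> (r \<oplus>\<^bsub>R\<^esub> s) \<odot>\<^bsub>M\<^esub> x = r \<odot>\<^bsub>M\<^esub> x \<oplus>\<^bsub>M\<^esub> s \<odot>\<^bsub>M\<^esub> x"
    and rsmult_r_distr: "\<lbrakk>r \<in> carrier R; x \<in> carrier M; y \<in> carrier M\<rbrakk>
      \<Longrightarrow> r \<odot>\<^bsub>M\<^esub> (x \<oplus>\<^bsub>M\<^esub> y) = r \<odot>\<^bsub>M\<^esub> x \<oplus>\<^bsub>M\<^esub> r \<odot>\<^bsub>M\<^esub> y"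
    and rsmult_assoc: "\<lbrakk>r \<in> carrier R; s \<in> carrier R; x \<in> carrier M\<rbrakk>
      \<Longrightarrow> (r \<otimes>\<^bsub>R\<^esub> s) \<odot>\<^bsub>M\<^esub> x = s \<odot>\<^bsub>M\<^esub> (r \<odot>\<^bsub>M\<^esub> x)"
    and rsmult_one: "x \<in> carrier M \<Longrightarrow> \<one>\<^bsub>R\<^esub> \<odot>\<^bsub>M\<^esub> x = x"

definition module_isomorphic ::
  "('a, 'c) ring_scheme \<Rightarrow> ('a, 'b1, 'd1) module_scheme \<Rightarrow> ('a, 'b2, 'd2) module_scheme \<Rightarrow> bool"
  where "module_isomorphic R M N \<longleftrightarrow>
    (\<exists>h \<in> LinearCombinations.module_hom R M N. bij_betw h (carrier M) (carrier N))"

definition right_simple :: "('a, 'c) ring_scheme \<Rightarrow> ('a, 'b, 'd) module_scheme \<Rightarrow> bool"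
  where "right_simple R M \<longleftrightarrow> right_module R M \<and> carrier M \<noteq> {\<zero>\<^bsub>M\<^esub>} \<and>
    (\<forall>N. Module.submodule N R M \<longrightarrow> N = {\<zero>\<^bsub>M\<^esub>} \<or> N = carrier M)"

definition right_regular :: "('a, 'c) ring_scheme \<Rightarrow> ('a, 'a) module"
  where "right_regular R = \<lparr>carrier = carrier R, mult = mult R, one = one R,
    zero = zero R, add = add R, smult = (\<lambda>r x. x \<otimes>\<^bsub>R\<^esub> r)\<rparr>"

definition left_regular :: "('a, 'c) ring_scheme \<Rightarrow> ('a, 'a) module"
  where "left_regular R = \<lparr>carrier = carrier R, mult = mult R, one = one R,
    zero = zero R, add = add R, smult = (\<lambda>r x. r \<otimes>\<^bsub>R\<^esub> x)\<rparr>"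

definition quotient_module :: "('a, 'b, 'd) module_scheme \<Rightarrow> 'b set \<Rightarrow> ('a, 'b set) module"
  where "quotient_module M N = \<lparr>carrier = A_RCOSETS M N, mult = undefined, one = undefined,
    zero = N, add = set_add M, smult = (\<lambda>r X. \<Union>x\<in>X. N +>\<^bsub>M\<^esub> (r \<odot>\<^bsub>M\<^esub> x))\<rparr>"


section \<open>Projective resolutions, global dimension, Ext\<close>

text \<open>
  HOL cannot quantify over types inside a formula, so homological notions are relative to a
  universe \<open>'u\<close>: modules are taken with carrier in the type \<open>'u\<close>. If \<open>'u\<close> is
  infinite and at least as large as the carrier of the ring, it contains (up to isomorphism) every
  cyclic module, and with each module a free module mapping onto it. For such \<open>'u\<close> the notions
  below agree with the absolute ones (for the global dimension, by Auslander's theorem that cyclic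
  modules suffice).
\<close>

definition right_projective :: "('a, 'c) ring_scheme \<Rightarrow> ('a, 'u) module \<Rightarrow> bool"
  where "right_projective R P \<longleftrightarrow> right_module R P \<and>
    (\<forall>(M :: ('a, 'u) module) (N :: ('a, 'u) module).
     \<forall>g \<in> LinearCombinations.module_hom R M N. \<forall>f \<in> LinearCombinations.module_hom R P N.
       right_module R M \<and> right_module R N \<and> g ` carrier M = carrier N \<longrightarrow>
       (\<exists>h \<in> LinearCombinations.module_hom R P M. \<forall>x \<in> carrier P. g (h x) = f x))"

definition projective_resolution ::
  "('a, 'c) ring_scheme \<Rightarrow> ('a, 'b) module \<Rightarrow> (nat \<Rightarrow> ('a, 'u) module) \<Rightarrow> (nat \<Rightarrow> 'u \<Rightarrow> 'u)
    \<Rightarrow> ('u \<Rightarrow> 'b) \<Rightarrow> bool"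
  where "projective_resolution R M P \<delta> \<epsilon> \<longleftrightarrow>
    (\<forall>i. right_projective R (P i)) \<and>
    (\<forall>i. \<delta> i \<in> LinearCombinations.module_hom R (P (Suc i)) (P i)) \<and>
    \<epsilon> \<in> LinearCombinations.module_hom R (P 0) M \<and> \<epsilon> ` carrier (P 0) = carrier M \<and>
    a_kernel (P 0) M \<epsilon> = \<delta> 0 ` carrier (P 1) \<and>
    (\<forall>i. a_kernel (P (Suc i)) (P i) (\<delta> i) = \<delta> (Suc i) ` carrier (P (Suc (Suc i))))"

definition projective_dim :: "('a, 'c) ring_scheme \<Rightarrow> ('a, 'u) module \<Rightarrow> enat"
  where "projective_dim R M =
    (INF n \<in> {n. \<exists>(P :: nat \<Rightarrow> ('a, 'u) module) \<delta> \<epsilon>. projective_resolution R M P \<delta> \<epsilon> \<and>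
        (\<forall>i>n. carrier (P i) = {\<zero>\<^bsub>P i\<^esub>})}. enat n)"

definition right_global_dim :: "'u itself \<Rightarrow> ('a, 'c) ring_scheme \<Rightarrow> enat"
  where "right_global_dim U R =
    (SUP M \<in> {M :: ('a, 'u) module. right_module R M}. projective_dim R M)"

text \<open>\<open>Hom\<^sub>R(P, R)\<close> with the left module structure \<open>(r f)(x) = r f(x)\<close>.\<close>

definition dual_module :: "('a, 'c) ring_scheme \<Rightarrow> ('a, 'u) module \<Rightarrow> ('a, 'u \<Rightarrow> 'a) module"
  where "dual_module R P = \<lparr>
    carrier = LinearCombinations.module_hom R P (right_regular R) \<inter> extensional (carrier P),
    mult = undefined, one = undefined,
    zero = (\<lambda>x \<in> carrier P. \<zero>\<^bsub>R\<^esub>),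
    add = (\<lambda>f g. \<lambda>x \<in> carrier P. f x \<oplus>\<^bsub>R\<^esub> g x),
    smult = (\<lambda>r f. \<lambda>x \<in> carrier P. r \<otimes>\<^bsub>R\<^esub> f x)\<rparr>"

definition dual_cocycles ::
  "('a, 'c) ring_scheme \<Rightarrow> (nat \<Rightarrow> ('a, 'u) module) \<Rightarrow> (nat \<Rightarrow> 'u \<Rightarrow> 'u) \<Rightarrow> nat \<Rightarrow> ('u \<Rightarrow> 'a) set"
  where "dual_cocycles R P \<delta> i = {f \<in> carrier (dual_module R (P i)).
    compose (carrier (P (Suc i))) f (\<delta> i) = \<zero>\<^bsub>dual_module R (P (Suc i))\<^esub>}"

definition dual_coboundaries ::
  "('a, 'c) ring_scheme \<Rightarrow> (nat \<Rightarrow> ('a, 'u) module) \<Rightarrow> (nat \<Rightarrow> 'u \<Rightarrow> 'u) \<Rightarrow> nat \<Rightarrow> ('u \<Rightarrow> 'a) set"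
  where "dual_coboundaries R P \<delta> i = (case i of
      0 \<Rightarrow> {\<zero>\<^bsub>dual_module R (P 0)\<^esub>}
    | Suc j \<Rightarrow> (\<lambda>f. compose (carrier (P (Suc j))) f (\<delta> j)) ` carrier (dual_module R (P j)))"

text \<open>The left module \<open>Ext\<^sup>i\<^sub>R(M, R)\<close>, computed from a projective resolution of \<open>M\<close>.\<close>

definition Ext_regular ::
  "('a, 'c) ring_scheme \<Rightarrow> (nat \<Rightarrow> ('a, 'u) module) \<Rightarrow> (nat \<Rightarrow> 'u \<Rightarrow> 'u) \<Rightarrow> nat
    \<Rightarrow> ('a, ('u \<Rightarrow> 'a) set) module"
  where "Ext_regular R P \<delta> i =
    quotient_module ((dual_module R (P i))\<lparr>carrier := dual_cocycles R P \<delta> i\<rparr>)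
      (dual_coboundaries R P \<delta> i)"


section \<open>Algebras over a field\<close>

text \<open>
  An algebra over a field \<open>'k\<close> is a module record over \<open>class_ring :: 'k ring\<close> which is at the same
  time a ring (the algebra locale of HOL-Algebra is restricted to commutative algebras).
\<close>

definition k_algebra :: "('k :: field, 'a) module \<Rightarrow> bool"
  where "k_algebra B \<longleftrightarrow> ring B \<and> vectorspace class_ring B \<and>
    (\<forall>c. \<forall>x \<in> carrier B. \<forall>y \<in> carrier B.
       (c \<odot>\<^bsub>B\<^esub> x) \<otimes>\<^bsub>B\<^esub> y = c \<odot>\<^bsub>B\<^esub> (x \<otimes>\<^bsub>B\<^esub> y) \<and>
       x \<otimes>\<^bsub>B\<^esub> (c \<odot>\<^bsub>B\<^esub> y) = c \<odot>\<^bsub>B\<^esub> (x \<otimes>\<^bsub>B\<^esub> y))"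

definition restrict_scalars :: "('k, 'a) module \<Rightarrow> ('a, 'b) module \<Rightarrow> ('k, 'b) module"
  where "restrict_scalars A M = \<lparr>carrier = carrier M, mult = mult M, one = one M,
    zero = zero M, add = add M, smult = (\<lambda>c x. (c \<odot>\<^bsub>A\<^esub> \<one>\<^bsub>A\<^esub>) \<odot>\<^bsub>M\<^esub> x)\<rparr>"

definition one_dimensional :: "('k :: field, 'a) module \<Rightarrow> ('a, 'b) module \<Rightarrow> bool"
  where "one_dimensional A M \<longleftrightarrow>
    vectorspace.fin_dim class_ring (restrict_scalars A M) \<and>
    vectorspace.dim class_ring (restrict_scalars A M) = 1"

definition connected_graded :: "('k :: field, 'a) module \<Rightarrow> (nat \<Rightarrow> 'a set) \<Rightarrow> bool"
  where "connected_graded B G \<longleftrightarrow> k_algebra B \<and>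
    (\<forall>i. VectorSpace.subspace class_ring (G i) B) \<and>
    (\<forall>i j. \<forall>x \<in> G i. \<forall>y \<in> G j. x \<otimes>\<^bsub>B\<^esub> y \<in> G (i + j)) \<and>
    (\<forall>b \<in> carrier B. \<exists>!c. (\<forall>i. c i \<in> G i) \<and> finite {i. c i \<noteq> \<zero>\<^bsub>B\<^esub>} \<and>
        b = finsum B c {i. c i \<noteq> \<zero>\<^bsub>B\<^esub>}) \<and>
    G 0 = {c \<odot>\<^bsub>B\<^esub> \<one>\<^bsub>B\<^esub> | c. True} \<and> \<one>\<^bsub>B\<^esub> \<noteq> \<zero>\<^bsub>B\<^esub>"

definition positive_part :: "('k :: field, 'a) module \<Rightarrow> (nat \<Rightarrow> 'a set) \<Rightarrow> 'a set"
  where "positive_part B G = LinearCombinations.module.span class_ring B (\<Union>i\<in>{1..}. G i)"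

text \<open>\<open>word_span B S n\<close> is \<open>V\<^sup>n\<close> for the subspace \<open>V\<close> spanned by \<open>S\<close> and the unit.\<close>

definition word_span :: "('k :: field, 'a) module \<Rightarrow> 'a set \<Rightarrow> nat \<Rightarrow> 'a set"
  where "word_span B S n = LinearCombinations.module.span class_ring B
    {foldr (\<lambda>x y. x \<otimes>\<^bsub>B\<^esub> y) xs \<one>\<^bsub>B\<^esub> | xs. set xs \<subseteq> S \<and> length xs \<le> n}"

definition gk_dim :: "('k :: field, 'a) module \<Rightarrow> ereal"
  where "gk_dim B = (SUP S \<in> {S. finite S \<and> S \<subseteq> carrier B}.
    limsup (\<lambda>n. ereal (log (real n)
      (real (vectorspace.dim class_ring (B\<lparr>carrier := word_span B S n\<rparr>))))))"

definition as_gorenstein ::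
  "'u itself \<Rightarrow> ('k :: field, 'a) module \<Rightarrow> (nat \<Rightarrow> 'a set) \<Rightarrow> nat \<Rightarrow> bool"
  where "as_gorenstein U B G d \<longleftrightarrow>
    (\<exists>(P :: nat \<Rightarrow> ('a, 'u) module) \<delta> \<epsilon>.
       projective_resolution B (quotient_module (right_regular B) (positive_part B G)) P \<delta> \<epsilon> \<and>
       (\<forall>i. i \<noteq> d \<longrightarrow> carrier (Ext_regular B P \<delta> i) = {\<zero>\<^bsub>Ext_regular B P \<delta> i\<^esub>}) \<and>
       module_isomorphic B (Ext_regular B P \<delta> d)
         (quotient_module (left_regular B) (positive_part B G)))"

definition as_regular ::
  "'u itself \<Rightarrow> ('k :: field, 'a) module \<Rightarrow> (nat \<Rightarrow> 'a set) \<Rightarrow> nat \<Rightarrow> bool"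
  where "as_regular U B G d \<longleftrightarrow> connected_graded B G \<and>
    right_global_dim U B = enat d \<and> gk_dim B < \<infinity> \<and> as_gorenstein U B G d"


section \<open>Presented algebras and homogenization\<close>

instantiation list :: (type) monoid_add
begin
definition plus_list :: "'a list \<Rightarrow> 'a list \<Rightarrow> 'a list" where "plus_list = append"
definition zero_list :: "'a list" where "zero_list = []"
instance by standard (simp_all add: plus_list_def zero_list_def)
end

text \<open>
  With this instance \<open>'x list \<Rightarrow>\<^sub>0 'k\<close> is the free algebra \<open>K\<langle>x | x :: 'x\<rangle>\<close>,
  equivalently the tensor algebra on the vector space with basis \<open>'x\<close>: its multiplication
  is the convolution along concatenation of words.
\<close>

type_synonym ('k, 'x) nc_poly = "'x list \<Rightarrow>\<^sub>0 'k"

definition nc_var :: "'x \<Rightarrow> ('k :: field, 'x) nc_poly"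
  where "nc_var x = Poly_Mapping.single [x] 1"

definition relation_ideal :: "('k :: field, 'x) nc_poly set \<Rightarrow> ('k, 'x) nc_poly set"
  where "relation_ideal F = genideal class_ring F"

definition nc_class :: "('k :: field, 'x) nc_poly set \<Rightarrow> ('k, 'x) nc_poly \<Rightarrow> ('k, 'x) nc_poly set"
  where "nc_class F f = relation_ideal F +>\<^bsub>class_ring\<^esub> f"

definition presented_algebra ::
  "('k :: field, 'x) nc_poly set \<Rightarrow> ('k, ('k, 'x) nc_poly set) module"
  where "presented_algebra F = (let Q = class_ring Quot relation_ideal F in
    \<lparr>carrier = carrier Q, mult = mult Q, one = one Q, zero = zero Q, add = add Q,
     smult = (\<lambda>c X. nc_class F (Poly_Mapping.single [] c) \<otimes>\<^bsub>Q\<^esub> X)\<rparr>)"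

definition nc_degree :: "('k :: field, 'x) nc_poly \<Rightarrow> nat"
  where "nc_degree f = Max (insert 0 (length ` Poly_Mapping.keys f))"

definition nc_homogeneous :: "nat \<Rightarrow> ('k :: field, 'x) nc_poly set"
  where "nc_homogeneous d = {f. \<forall>w \<in> Poly_Mapping.keys f. length w = d}"

text \<open>The new variable \<open>x\<^sub>0\<close> is \<open>None\<close>, and \<open>x\<^sub>i\<close> becomes \<open>Some i\<close>.\<close>

definition homogenize :: "('k :: field, 'x) nc_poly \<Rightarrow> ('k, 'x option) nc_poly"
  where "homogenize f = (\<Sum>w \<in> Poly_Mapping.keys f.
    Poly_Mapping.single (replicate (nc_degree f - length w) None @ map Some w)
      (Poly_Mapping.lookup f w))"

definition homogenization_relations ::
  "('k :: field, 'x) nc_poly list \<Rightarrow> ('k, 'x option) nc_poly set"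
  where "homogenization_relations fs = homogenize ` set fs \<union>
    {nc_var None * nc_var (Some i) - nc_var (Some i) * nc_var None | i. True}"

definition homogenization ::
  "('k :: field, 'x) nc_poly list \<Rightarrow> ('k, ('k, 'x option) nc_poly set) module"
  where "homogenization fs = presented_algebra (homogenization_relations fs)"

definition homogenization_grading ::
  "('k :: field, 'x) nc_poly list \<Rightarrow> nat \<Rightarrow> ('k, 'x option) nc_poly set set"
  where "homogenization_grading fs i = nc_class (homogenization_relations fs) ` nc_homogeneous i"

text \<open>
  The universe is the power set of the free algebra; it is infinite and at least as large as the
  homogenization, whose elements are cosets.
\<close>

definition essentially_regular :: "('k :: field, 'x) nc_poly list \<Rightarrow> nat \<Rightarrow> bool"
  where "essentially_regular fs d \<longleftrightarrow>
    as_regular TYPE(('k, 'x option) nc_poly set) (homogenization fs)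
      (homogenization_grading fs) (d + 1)"

definition x0_not_zero_divisor :: "('k :: field, 'x) nc_poly list \<Rightarrow> bool"
  where "x0_not_zero_divisor fs \<longleftrightarrow>
    (let H = homogenization fs; x0 = nc_class (homogenization_relations fs) (nc_var None) in
      \<forall>b \<in> carrier H. (x0 \<otimes>\<^bsub>H\<^esub> b = \<zero>\<^bsub>H\<^esub> \<longrightarrow> b = \<zero>\<^bsub>H\<^esub>) \<and> (b \<otimes>\<^bsub>H\<^esub> x0 = \<zero>\<^bsub>H\<^esub> \<longrightarrow> b = \<zero>\<^bsub>H\<^esub>))"


section \<open>Closed subschemes of projective space\<close>

text \<open>Commutative polynomials: \<open>'v \<Rightarrow>\<^sub>0 nat\<close> is the type of monomials.\<close>

type_synonym ('k, 'v) comm_poly = "('v \<Rightarrow>\<^sub>0 nat) \<Rightarrow>\<^sub>0 'k"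

definition cp_var :: "'v \<Rightarrow> ('k :: field, 'v) comm_poly"
  where "cp_var i = Poly_Mapping.single (Poly_Mapping.single i 1) 1"

definition mono_degree :: "('v \<Rightarrow>\<^sub>0 nat) \<Rightarrow> nat"
  where "mono_degree m = (\<Sum>i \<in> Poly_Mapping.keys m. Poly_Mapping.lookup m i)"

definition cp_homogeneous :: "nat \<Rightarrow> ('k :: field, 'v) comm_poly set"
  where "cp_homogeneous d = {f. \<forall>m \<in> Poly_Mapping.keys f. mono_degree m = d}"

definition cp_component :: "nat \<Rightarrow> ('k :: field, 'v) comm_poly \<Rightarrow> ('k, 'v) comm_poly"
  where "cp_component d f = (\<Sum>m \<in> {m \<in> Poly_Mapping.keys f. mono_degree m = d}.
    Poly_Mapping.single m (Poly_Mapping.lookup f m))"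

definition cp_eval :: "('k :: field, 'v) comm_poly \<Rightarrow> ('v \<Rightarrow> 'k) \<Rightarrow> 'k"
  where "cp_eval f v = (\<Sum>m \<in> Poly_Mapping.keys f. Poly_Mapping.lookup f m *
    (\<Prod>i \<in> Poly_Mapping.keys m. v i ^ Poly_Mapping.lookup m i))"

definition cp_subst ::
  "('k :: field, 'v) comm_poly \<Rightarrow> ('v \<Rightarrow> ('k, 'v) comm_poly) \<Rightarrow> ('k, 'v) comm_poly"
  where "cp_subst f F = (\<Sum>m \<in> Poly_Mapping.keys f.
    Poly_Mapping.single 0 (Poly_Mapping.lookup f m) *
    (\<Prod>i \<in> Poly_Mapping.keys m. F i ^ Poly_Mapping.lookup m i))"

text \<open>A point of projective space is the set of its homogeneous coordinate vectors.\<close>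

type_synonym ('k, 'v) proj_point = "('v \<Rightarrow> 'k) set"

definition proj_class :: "('v \<Rightarrow> 'k :: field) \<Rightarrow> ('k, 'v) proj_point"
  where "proj_class v = {(\<lambda>i. c * v i) | c. c \<noteq> 0}"

definition proj_space :: "('k :: field, 'v) proj_point set"
  where "proj_space = {proj_class v | v. v \<noteq> (\<lambda>_. 0)}"

text \<open>
  A closed subscheme \<open>E\<close> of projective space, possibly nonreduced, is given by a homogeneous
  ideal of the homogeneous coordinate ring \<open>S\<close>. By \<open>cone_points\<close> we mean the coordinate vectors of
  its \<open>K\<close>-rational (equivalently, closed) points.
\<close>

definition closed_subscheme :: "('k :: field, 'v) comm_poly set \<Rightarrow> bool"
  where "closed_subscheme E \<longleftrightarrow> ideal E class_ring \<and> (\<forall>f \<in> E. \<forall>d. cp_component d f \<in> E)"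

definition cone_points :: "('k :: field, 'v) comm_poly set \<Rightarrow> ('v \<Rightarrow> 'k) set"
  where "cone_points E = {v. v \<noteq> (\<lambda>_. 0) \<and> (\<forall>f \<in> E. cp_eval f v = 0)}"

definition scheme_points :: "('k :: field, 'v) comm_poly set \<Rightarrow> ('k, 'v) proj_point set"
  where "scheme_points E = proj_class ` cone_points E"

text \<open>
  For \<open>g\<close> homogeneous of positive degree, the ring of functions on \<open>E \<inter> D\<^sub>+(g)\<close> is the degree zero
  part of \<open>(S/E)\<^sub>g\<close>; so a homogeneous \<open>f\<close> vanishes identically (as a section) on
  \<open>E \<inter> D\<^sub>+(g)\<close> iff some \<open>g\<^sup>N f\<close> lies in \<open>E\<close>.
\<close>

definition vanishes_on_basic_open ::
  "('k :: field, 'v) comm_poly set \<Rightarrow> ('k, 'v) comm_poly \<Rightarrow> ('k, 'v) comm_poly \<Rightarrow> bool"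
  where "vanishes_on_basic_open E g f \<longleftrightarrow> (\<exists>N. g ^ N * f \<in> E)"

text \<open>
  A morphism of schemes \<open>E \<rightarrow> E\<close> over \<open>K\<close> is given by an atlas \<open>C\<close> of charts \<open>(g, F)\<close>: on
  \<open>E \<inter> D\<^sub>+(g)\<close> it is \<open>x \<mapsto> (F i (x))\<^sub>i\<close>, where the \<open>F i\<close> are homogeneous of the same degree
  without common zero on \<open>E \<inter> D\<^sub>+(g)\<close>. (Every morphism arises so: trivialize the pullback of
  \<open>O(1)\<close> on basic opens and clear denominators.) The conditions say, in order, that each chart
  is well-formed, that it maps into the scheme \<open>E\<close>, that the charts cover \<open>E\<close>, and that they
  agree scheme-theoretically on overlaps.
\<close>

type_synonym ('k, 'v) atlas = "(('k, 'v) comm_poly \<times> ('v \<Rightarrow> ('k, 'v) comm_poly)) set"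

definition scheme_endomorphism :: "('k :: field, 'v) comm_poly set \<Rightarrow> ('k, 'v) atlas \<Rightarrow> bool"
  where "scheme_endomorphism E C \<longleftrightarrow>
    (\<forall>(g, F) \<in> C. (\<exists>d>0. g \<in> cp_homogeneous d) \<and> (\<exists>d. \<forall>i. F i \<in> cp_homogeneous d) \<and>
       (\<forall>v \<in> cone_points E. cp_eval g v \<noteq> 0 \<longrightarrow> (\<exists>i. cp_eval (F i) v \<noteq> 0))) \<and>
    (\<forall>(g, F) \<in> C. \<forall>h \<in> E. vanishes_on_basic_open E g (cp_subst h F)) \<and>
    (\<forall>v \<in> cone_points E. \<exists>(g, F) \<in> C. cp_eval g v \<noteq> 0) \<and>
    (\<forall>(g, F) \<in> C. \<forall>(g', F') \<in> C. \<forall>i j.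
       vanishes_on_basic_open E (g * g') (F i * F' j - F j * F' i))"

text \<open>
  The composite \<open>C'\<close> after \<open>C\<close> is the identity of \<open>E\<close>. Where \<open>(g, F)\<close> is followed by
  \<open>(g', F')\<close>, the composite is defined on \<open>E \<inter> D\<^sub>+(g \<cdot> g'(F))\<close>.
\<close>

definition atlas_left_inverse ::
  "('k :: field, 'v) comm_poly set \<Rightarrow> ('k, 'v) atlas \<Rightarrow> ('k, 'v) atlas \<Rightarrow> bool"
  where "atlas_left_inverse E C' C \<longleftrightarrow>
    (\<forall>(g, F) \<in> C. \<forall>(g', F') \<in> C'. \<forall>i j.
       vanishes_on_basic_open E (g * cp_subst g' F)
         (cp_subst (F' i) F * cp_var j - cp_subst (F' j) F * cp_var i))"

definition scheme_automorphism :: "('k :: field, 'v) comm_poly set \<Rightarrow> ('k, 'v) atlas \<Rightarrow> bool"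
  where "scheme_automorphism E C \<longleftrightarrow> scheme_endomorphism E C \<and>
    (\<exists>C'. scheme_endomorphism E C' \<and> atlas_left_inverse E C' C \<and> atlas_left_inverse E C C')"

definition atlas_map :: "('k :: field, 'v) atlas \<Rightarrow> ('k, 'v) proj_point \<Rightarrow> ('k, 'v) proj_point"
  where "atlas_map C p = (THE q. \<exists>(g, F) \<in> C. \<exists>v \<in> p. cp_eval g v \<noteq> 0 \<and>
    q = proj_class (\<lambda>i. cp_eval (F i) v))"


section \<open>Geometric algebras\<close>

text \<open>
  \<open>nc_homogeneous 2\<close> is \<open>V \<otimes> V\<close>, where \<open>V\<close> has basis \<open>'v\<close>; the word \<open>[i, j]\<close> is
  \<open>x\<^sub>i \<otimes> x\<^sub>j\<close>.
\<close>

definition bilinear_eval :: "('k :: field, 'v :: finite) nc_poly \<Rightarrow> ('v \<Rightarrow> 'k) \<Rightarrow> ('v \<Rightarrow> 'k) \<Rightarrow> 'k"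
  where "bilinear_eval f a b =
    (\<Sum>i \<in> UNIV. \<Sum>j \<in> UNIV. Poly_Mapping.lookup f [i, j] * a i * b j)"

definition vanishes_at ::
  "('k :: field, 'v :: finite) nc_poly \<Rightarrow> ('k, 'v) proj_point \<Rightarrow> ('k, 'v) proj_point \<Rightarrow> bool"
  where "vanishes_at f p q \<longleftrightarrow> (\<forall>a \<in> p. \<forall>b \<in> q. bilinear_eval f a b = 0)"

definition zero_locus ::
  "('k :: field, 'v :: finite) nc_poly set \<Rightarrow> (('k, 'v) proj_point \<times> ('k, 'v) proj_point) set"
  where "zero_locus R =
    {(p, q). p \<in> proj_space \<and> q \<in> proj_space \<and> (\<forall>f \<in> R. vanishes_at f p q)}"

text \<open>
  \<open>geometric F E \<sigma>\<close>: the algebra presented by the relations \<open>F\<close> is a quadratic algebra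
  \<open>T(V)/(R)\<close> which is geometric with geometric data \<open>(E, \<sigma>)\<close>. The last conjunct makes \<open>R\<close> a
  linear subspace.
\<close>

definition geometric ::
  "('k :: field, 'v :: finite) nc_poly set \<Rightarrow> ('k, 'v) comm_poly set \<Rightarrow> ('k, 'v) atlas \<Rightarrow> bool"
  where "geometric F E \<sigma> \<longleftrightarrow> closed_subscheme E \<and> scheme_automorphism E \<sigma> \<and>
    (\<exists>R \<subseteq> nc_homogeneous 2. relation_ideal R = relation_ideal F \<and>
       zero_locus R = {(p, atlas_map \<sigma> p) | p. p \<in> scheme_points E} \<and>
       R = {f \<in> nc_homogeneous 2. \<forall>p \<in> scheme_points E. vanishes_at f p (atlas_map \<sigma> p)})"


section \<open>The modules attached to points\<close>

definition affine_points ::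
  "('k :: field, 'x option) comm_poly set \<Rightarrow> ('k, 'x option) proj_point set"
  where "affine_points E = {p \<in> scheme_points E. \<forall>v \<in> p. v None \<noteq> 0}"

definition affine_coord :: "('k :: field, 'x option) proj_point \<Rightarrow> 'x \<Rightarrow> 'k"
  where "affine_coord p i = (THE v. v \<in> p \<and> v None = 1) (Some i)"

definition point_right_ideal ::
  "('k :: field, 'x :: finite) nc_poly set \<Rightarrow> ('k, 'x option) proj_point
    \<Rightarrow> ('k, 'x) nc_poly set set"
  where "point_right_ideal F p = (let A = presented_algebra F in
    {finsum A (\<lambda>i. nc_class F (nc_var i - Poly_Mapping.single [] (affine_coord p i)) \<otimes>\<^bsub>A\<^esub> a i) UNIV
      | a. \<forall>i. a i \<in> carrier A})"

definition point_module ::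
  "('k :: field, 'x :: finite) nc_poly set \<Rightarrow> ('k, 'x option) proj_point
    \<Rightarrow> (('k, 'x) nc_poly set, ('k, 'x) nc_poly set set) module"
  where "point_module F p =
    quotient_module (right_regular (presented_algebra F)) (point_right_ideal F p)"

end

theory Submission
  imports Defs
begin

text \<open>
  A one-dimensional right module is a character of \<open>A\<close>, that is, a point \<open>v\<close> of affine space at which
  all relations of \<open>A\<close> vanish. At \<open>(1 : v)\<close> the homogenized relations take the same values as the
  relations at \<open>v\<close>, and the relations making \<open>x\<^sub>0\<close> central force \<open>\<sigma>(p) = p\<close> for \<open>p \<in> E\<^sub>1\<close>; hence these
  points are exactly the points of \<open>E\<^sub>1\<close>. The right ideal generated by the \<open>x\<^sub>i - v\<^sub>i\<close> is the kernel of
  the character, so the point module is the corresponding module. The values of the character on the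
  generators recover the point.
\<close>

section \<open>Evaluation of noncommutative polynomials at a commutative point\<close>

lemma nc_poly_expand: "(\<Sum>w \<in> Poly_Mapping.keys f. Poly_Mapping.single w (Poly_Mapping.lookup f w)) = f"
  by (rule poly_mapping_eqI)
    (auto simp: lookup_sum lookup_single when_def in_keys_iff)

text \<open>The algebra homomorphism from the free algebra to K that sends the generator
  \<open>x\<close> to \<open>v x\<close>.\<close>

definition nc_eval :: "('x \<Rightarrow> 'k :: field) \<Rightarrow> ('k, 'x) nc_poly \<Rightarrow> 'k"
  where "nc_eval v f = (\<Sum>w \<in> Poly_Mapping.keys f. Poly_Mapping.lookup f w * prod_list (map v w))"

text \<open>Words outside the support have coefficient zero. A common index set lets evaluations of
  different polynomials be combined.\<close>

lemma nc_eval_superset: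
  "finite S \<Longrightarrow> Poly_Mapping.keys f \<subseteq> S \<Longrightarrow>
    nc_eval v f = (\<Sum>w \<in> S. Poly_Mapping.lookup f w * prod_list (map v w))"
  unfolding nc_eval_def by (rule sum.mono_neutral_left) (auto simp: in_keys_iff)

lemma nc_eval_zero [simp]: "nc_eval v 0 = 0"
  by (simp add: nc_eval_def)

lemma nc_eval_single [simp]: "nc_eval v (Poly_Mapping.single w c) = c * prod_list (map v w)"
  by (simp add: nc_eval_def)

lemma nc_eval_var [simp]: "nc_eval v (nc_var x) = v x"
  by (simp add: nc_var_def)

lemma single_Nil_one: "Poly_Mapping.single [] 1 = (1 :: ('k :: field, 'x) nc_poly)"
  by (simp flip: zero_list_def)

lemma nc_eval_surj: "surj (nc_eval v)"
  by (rule surjI[of _ "Poly_Mapping.single []"]) simp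

lemma nc_eval_one [simp]: "nc_eval v 1 = 1"
  using nc_eval_single[of v "[]" 1] by (simp add: single_Nil_one)

lemma nc_eval_add [simp]: "nc_eval v (f + g) = nc_eval v f + nc_eval v g"
proof -
  let ?S = "Poly_Mapping.keys f \<union> Poly_Mapping.keys g"
  have "Poly_Mapping.keys (f + g) \<subseteq> ?S" by (rule Poly_Mapping.keys_add)
  then show ?thesis
    by (simp add: nc_eval_superset[of ?S] lookup_add distrib_right sum.distrib)
qed

lemma nc_eval_sum [simp]: "nc_eval v (sum h X) = (\<Sum>x \<in> X. nc_eval v (h x))"
  by (induction X rule: infinite_finite_induct) auto

text \<open>Expansion into terms reduces this to two words, whose product is their concatenation;
  commutativity of K then sorts the scalars.\<close>

lemma nc_eval_mult [simp]: "nc_eval v (f * g) = nc_eval v f * nc_eval v g"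
proof -
  let ?s = "\<lambda>f w. Poly_Mapping.single w (Poly_Mapping.lookup f w)"
  have "f * g = (\<Sum>u \<in> Poly_Mapping.keys f. \<Sum>w \<in> Poly_Mapping.keys g. ?s f u * ?s g w)"
    by (simp flip: sum_product add: nc_poly_expand)
  also have "nc_eval v \<dots> = nc_eval v f * nc_eval v g"
    by (simp add: mult_single plus_list_def) (simp add: nc_eval_def sum_product mult_ac)
  finally show ?thesis .
qed

lemma nc_eval_uminus [simp]: "nc_eval v (- f) = - nc_eval v f"
  using nc_eval_add[of v f "- f"] by (simp add: eq_neg_iff_add_eq_0 add.commute)

lemma nc_eval_diff [simp]: "nc_eval v (f - g) = nc_eval v f - nc_eval v g"
  using nc_eval_add[of v f "- g"] by simp

text \<open>The letter \<open>None\<close> has the value 1, so padding a term with powers of x_0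
  leaves its value unchanged.\<close>

lemma nc_eval_homogenize: "nc_eval (case_option 1 v) (homogenize f) = nc_eval v f"
  by (simp add: homogenize_def comp_def) (simp add: nc_eval_def)

text \<open>Connects characters, which evaluate at one point, with pairs (p, p) of the zero
  locus.\<close>

lemma nc_eval_quadratic:
  fixes f :: "('k :: field, 'v :: finite) nc_poly"
  assumes "f \<in> nc_homogeneous 2"
  shows "nc_eval v f = bilinear_eval f v v"
proof -
  let ?S = "(\<lambda>(i, j). [i, j]) ` (UNIV :: ('v \<times> 'v) set)"
  have "Poly_Mapping.keys f \<subseteq> ?S"
    using assms by (fastforce simp: nc_homogeneous_def numeral_2_eq_2 length_Suc_conv image_iff)
  then have "nc_eval v f = (\<Sum>w \<in> ?S. Poly_Mapping.lookup f w * prod_list (map v w))"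
    by (intro nc_eval_superset) auto
  also have "\<dots> = bilinear_eval f v v"
    by (subst sum.reindex)
      (auto simp: inj_on_def bilinear_eval_def sum.cartesian_product mult.assoc intro!: sum.cong)
  finally show ?thesis .
qed

text \<open>Modulo the right ideal generated by the x_i - v_i every polynomial is congruent to its
  value at v. For words this is an induction that peels off the first letter: x w = (x - v x) w + (v
  x) w.\<close>

lemma nc_eval_decompose:
  fixes f :: "('k :: field, 'x :: finite) nc_poly"
  shows "\<exists>b. f = Poly_Mapping.single [] (nc_eval v f) +
    (\<Sum>i \<in> UNIV. (nc_var i - Poly_Mapping.single [] (v i)) * b i)"
proof -
  let ?x = "\<lambda>i. nc_var i - Poly_Mapping.single [] (v i)"
  let ?P = "\<lambda>f. \<exists>b. f = Poly_Mapping.single [] (nc_eval v f) + (\<Sum>i \<in> UNIV. ?x i * b i)"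
  have add: "?P (f + g)" if fg: "?P f" "?P g" for f g
  proof -
    obtain b c where b: "f = Poly_Mapping.single [] (nc_eval v f) + (\<Sum>i \<in> UNIV. ?x i * b i)"
      and c: "g = Poly_Mapping.single [] (nc_eval v g) + (\<Sum>i \<in> UNIV. ?x i * c i)"
      using fg by blast
    have "f + g = (Poly_Mapping.single [] (nc_eval v f) + (\<Sum>i \<in> UNIV. ?x i * b i))
        + (Poly_Mapping.single [] (nc_eval v g) + (\<Sum>i \<in> UNIV. ?x i * c i))"
      using b c by simp
    also have "\<dots> = Poly_Mapping.single [] (nc_eval v (f + g)) + (\<Sum>i \<in> UNIV. ?x i * (b i + c i))"
      by (simp add: single_add distrib_left sum.distrib)
    finally show ?thesis by (rule exI[where x = "\<lambda>i. b i + c i"])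
  qed
  have single: "?P (Poly_Mapping.single w t)" for w t
  proof (induction w arbitrary: t)
    case Nil
    show ?case by (rule exI[of _ "\<lambda>_. 0"]) simp
  next
    case (Cons x w)
    let ?w = "Poly_Mapping.single w t"
    have 1: "?P (?x x * ?w)"
      by (rule exI[of _ "\<lambda>i. if i = x then ?w else 0"]) (simp add: if_distrib cong: if_cong)
    have "Poly_Mapping.single (x # w) t = ?x x * ?w + Poly_Mapping.single w (v x * t)"
      by (simp add: left_diff_distrib nc_var_def mult_single plus_list_def)
    then show ?case using add[OF 1 Cons.IH[of "v x * t"]] by simp
  qed
  have "?P (\<Sum>w \<in> S. Poly_Mapping.single w (Poly_Mapping.lookup f w))" if "finite S" for S
    using that
  proof (induction S rule: finite_induct)
    case empty
    show ?case by (rule exI[of _ "\<lambda>_. 0"]) simp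
  next
    case (insert w S)
    show ?case using add[OF single insert.IH] insert.hyps by simp
  qed
  from this[OF finite_keys[of f]] show ?thesis by (simp add: nc_poly_expand)
qed


section \<open>Relation ideals\<close>

lemma ideal_class_ringI:
  fixes J :: "'a :: ring_1 set"
  assumes "0 \<in> J" and "\<And>f g. f \<in> J \<Longrightarrow> g \<in> J \<Longrightarrow> f + g \<in> J"
    and l: "\<And>f g. f \<in> J \<Longrightarrow> g * f \<in> J" and "\<And>f g. f \<in> J \<Longrightarrow> f * g \<in> J"
  shows "ideal J class_ring"
proof (rule idealI)
  \<comment> \<open>Closure under negation comes from multiplication by -1.\<close>
  have "- f \<in> J" if "f \<in> J" for f
    using l[OF that, of "- 1"] by simp
  moreover have minus: "inv\<^bsub>add_monoid class_ring\<^esub> f = - f" for f :: 'a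
    by (subst a_inv_def[symmetric]) (simp only: class_ring_simps)
  ultimately show "subgroup J (add_monoid class_ring)"
    using assms minus by (intro subgroup.intro) simp_all
qed (use assms in \<open>auto simp: class_ring.ring_axioms\<close>)

lemma relation_ideal_ideal: "ideal (relation_ideal F) class_ring"
  unfolding relation_ideal_def by (rule ring.genideal_ideal[OF class_ring.ring_axioms]) simp

lemma relation_ideal_superset: "F \<subseteq> relation_ideal F"
  unfolding relation_ideal_def by (rule ring.genideal_self[OF class_ring.ring_axioms]) simp

lemma relation_ideal_minimal: "ideal J class_ring \<Longrightarrow> F \<subseteq> J \<Longrightarrow> relation_ideal F \<subseteq> J"
  unfolding relation_ideal_def by (rule ring.genideal_minimal[OF class_ring.ring_axioms])

text \<open>The kernel of evaluation is a two-sided ideal; once it contains \<open>F\<close>, it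
  contains the ideal generated by \<open>F\<close>.\<close>

lemma nc_eval_relation_ideal:
  assumes "\<forall>f \<in> F. nc_eval v f = 0" and "f \<in> relation_ideal F"
  shows "nc_eval v f = 0"
proof -
  have "ideal {f. nc_eval v f = 0} class_ring"
    by (rule ideal_class_ringI) auto
  from relation_ideal_minimal[OF this, of F] assms show ?thesis by auto
qed

text \<open>A word factors in exactly \<open>length w + 1\<close> ways, into a prefix and the
  remaining suffix, so the convolution is a sum over the cut positions.\<close>

lemma lookup_mult_list:
  fixes f g :: "'x list \<Rightarrow>\<^sub>0 'k :: semiring_0"
  shows "Poly_Mapping.lookup (f * g) w =
    (\<Sum>n \<le> length w. Poly_Mapping.lookup f (take n w) * Poly_Mapping.lookup g (drop n w))"
proof -
  let ?h = "\<lambda>l. Poly_Mapping.lookup f l * (\<Sum>q. Poly_Mapping.lookup g q when w = l + q)"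
  let ?S = "(\<lambda>n. take n w) ` {..length w}"
  have "?h l = 0" if "l \<notin> ?S" for l
  proof -
    have "w \<noteq> l + q" for q
      using that by (force simp: plus_list_def intro: image_eqI[of _ _ "length l"])
    then show ?thesis by simp
  qed
  then have sub: "{l. ?h l \<noteq> 0} \<subseteq> ?S" by blast
  have "Poly_Mapping.lookup (f * g) w = sum ?h ?S"
    unfolding lookup_mult by (rule Sum_any.expand_superset[OF _ sub]) simp
  also have "\<dots> = (\<Sum>n \<le> length w. ?h (take n w))"
    by (rule sum.reindex_cong[of "\<lambda>n. take n w"]) (auto simp: inj_on_def dest: arg_cong[of _ _ length])
  also have "\<dots> = (\<Sum>n \<le> length w. Poly_Mapping.lookup f (take n w) * Poly_Mapping.lookup g (drop n w))"
  proof (rule sum.cong)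
    fix n
    have "w = take n w + q \<longleftrightarrow> drop n w = q" for q
      using append_take_drop_id[of n w] by (metis append_eq_conv_conj plus_list_def same_append_eq)
    then show "?h (take n w) = Poly_Mapping.lookup f (take n w) * Poly_Mapping.lookup g (drop n w)"
      by simp
  qed simp
  finally show ?thesis .
qed

text \<open>
  The ideal generated by quadratic relations has no elements with terms of degree below two, and its
  quadratic terms come from the span of the relations.
\<close>

lemma bilinear_eval_relation_ideal:
  fixes R :: "('k :: field, 'v :: finite) nc_poly set"
  assumes "R \<subseteq> nc_homogeneous 2" and "\<forall>f \<in> R. bilinear_eval f a b = 0" and "f \<in> relation_ideal R"
  shows "bilinear_eval f a b = 0"
proof -
  \<comment> \<open>With no terms of degree below two in f, the coefficient of g f at
    \<open>[i, j]\<close> is the constant term of g times that of f, and likewise for f g. The first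
    two conditions therefore make this set an ideal.\<close>
  let ?J = "{f. Poly_Mapping.lookup f [] = 0 \<and> (\<forall>i. Poly_Mapping.lookup f [i] = 0) \<and> bilinear_eval f a b = 0}"
  have smult: "(\<Sum>i\<in>UNIV. \<Sum>j\<in>UNIV. c * Poly_Mapping.lookup g [i, j] * a i * b j) = c * bilinear_eval g a b"
    "(\<Sum>i\<in>UNIV. \<Sum>j\<in>UNIV. Poly_Mapping.lookup g [i, j] * c * a i * b j) = c * bilinear_eval g a b" for c g
    by (simp_all add: bilinear_eval_def sum_distrib_left mult_ac)
  have "ideal ?J class_ring"
    by (rule ideal_class_ringI)
      (auto simp: bilinear_eval_def lookup_add distrib_right sum.distrib lookup_mult_list
        numeral_2_eq_2 smult[unfolded bilinear_eval_def])
  moreover have "R \<subseteq> ?J"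
  proof -
    have "Poly_Mapping.lookup f w = 0" if "f \<in> R" "length w \<noteq> 2" for f w
      using that assms(1)
      by (auto simp: nc_homogeneous_def subset_iff simp flip: not_in_keys_iff_lookup_eq_zero)
    then show ?thesis using assms(2) by auto
  qed
  ultimately show ?thesis
    using relation_ideal_minimal assms(3) by blast
qed


section \<open>Presented algebras\<close>

lemma carrier_presented: "carrier (presented_algebra F) = range (nc_class F)"
  by (simp add: presented_algebra_def Let_def FactRing_def A_RCOSETS_def RCOSETS_def a_r_coset_def
      nc_class_def image_def) auto

lemma zero_presented: "\<zero>\<^bsub>presented_algebra F\<^esub> = nc_class F 0"
proof -
  interpret ideal "relation_ideal F" class_ring by (rule relation_ideal_ideal)
  show ?thesis by (simp add: presented_algebra_def FactRing_def nc_class_def Let_def a_r_coset_def r_coset_def)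
qed

lemma one_presented: "\<one>\<^bsub>presented_algebra F\<^esub> = nc_class F 1"
  by (simp add: presented_algebra_def FactRing_def nc_class_def Let_def)

lemma nc_class_add: "nc_class F f \<oplus>\<^bsub>presented_algebra F\<^esub> nc_class F g = nc_class F (f + g)"
proof -
  interpret ideal "relation_ideal F" class_ring by (rule relation_ideal_ideal)
  show ?thesis
    using a_rcos_sum[of f g] by (simp add: presented_algebra_def FactRing_def nc_class_def Let_def)
qed

lemma nc_class_mult: "nc_class F f \<otimes>\<^bsub>presented_algebra F\<^esub> nc_class F g = nc_class F (f * g)"
proof -
  interpret ideal "relation_ideal F" class_ring by (rule relation_ideal_ideal)
  show ?thesis
    using rcoset_mult_add[of f g] by (simp add: presented_algebra_def FactRing_def nc_class_def Let_def)
qed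

text \<open>Identifies the scalars through which \<open>restrict_scalars\<close> acts with the
  classes of constant polynomials.\<close>

lemma smult_one_presented:
  "c \<odot>\<^bsub>presented_algebra F\<^esub> \<one>\<^bsub>presented_algebra F\<^esub> = nc_class F (Poly_Mapping.single [] c)"
proof -
  have "c \<odot>\<^bsub>presented_algebra F\<^esub> \<one>\<^bsub>presented_algebra F\<^esub> =
      nc_class F (Poly_Mapping.single [] c) \<otimes>\<^bsub>presented_algebra F\<^esub> nc_class F 1"
    by (simp add: presented_algebra_def Let_def FactRing_def nc_class_def)
  then show ?thesis by (simp add: nc_class_mult)
qed

lemma ring_presented: "ring (presented_algebra F)"
proof -
  show ?thesis
  proof (rule ringI)
    show "abelian_group (presented_algebra F)"
    proof (rule abelian_groupI)
      fix x assume "x \<in> carrier (presented_algebra F)"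
      then obtain f where "x = nc_class F f" by (auto simp: carrier_presented)
      then show "\<exists>y\<in>carrier (presented_algebra F). y \<oplus>\<^bsub>presented_algebra F\<^esub> x = \<zero>\<^bsub>presented_algebra F\<^esub>"
        by (intro bexI[of _ "nc_class F (- f)"]) (auto simp: carrier_presented nc_class_add zero_presented)
    qed (auto simp: carrier_presented nc_class_add zero_presented add_ac)
    show "Group.monoid (presented_algebra F)"
      by (rule monoidI) (auto simp: carrier_presented nc_class_mult one_presented mult.assoc)
  qed (auto simp: carrier_presented nc_class_add nc_class_mult distrib_left distrib_right)
qed

lemma nc_class_eq_zero: "f \<in> F \<Longrightarrow> nc_class F f = nc_class F 0"
proof -
  assume "f \<in> F"
  interpret ideal "relation_ideal F" class_ring by (rule relation_ideal_ideal)
  have "f \<in> relation_ideal F" using \<open>f \<in> F\<close> relation_ideal_superset by blast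
  from a_rcos_const[OF this] a_rcos_const[OF zero_closed] show ?thesis
    by (simp add: nc_class_def)
qed

lemma nc_class_finsum:
  assumes "finite X"
  shows "finsum (presented_algebra F) (\<lambda>i. nc_class F (h i)) X = nc_class F (sum h X)"
proof -
  interpret ring "presented_algebra F" by (rule ring_presented)
  show ?thesis
    using assms
    by (induction X rule: finite_induct) (auto simp: zero_presented carrier_presented nc_class_add)
qed

text \<open>Meaningful only if the relations vanish at \<open>v\<close>, so that evaluation is constant on cosets.\<close>

definition algebra_character :: "('x \<Rightarrow> 'k :: field) \<Rightarrow> ('k, 'x) nc_poly set \<Rightarrow> 'k"
  where "algebra_character v X = the_elem (nc_eval v ` X)"

text \<open>Members of a coset differ by elements of the relation ideal, where evaluation vanishes,
  so the image of the coset is a singleton.\<close>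

lemma algebra_character_nc_class:
  assumes "\<forall>f \<in> F. nc_eval v f = 0"
  shows "algebra_character v (nc_class F f) = nc_eval v f"
proof -
  interpret ideal "relation_ideal F" class_ring by (rule relation_ideal_ideal)
  \<comment> \<open>This puts f into its own coset, so the image is nonempty.\<close>
  have "0 \<in> relation_ideal F" using zero_closed by simp
  then have "nc_eval v ` nc_class F f = {nc_eval v f}"
    using nc_eval_relation_ideal[OF assms] by (force simp: nc_class_def a_r_coset_def r_coset_def)
  then show ?thesis by (simp add: algebra_character_def)
qed


section \<open>Point modules\<close>

text \<open>The character kills the generators x_i - p_i. Conversely, a representative of value zero
  is a combination of them with coefficients on the right, by
  \<open>nc_eval_decompose\<close>.\<close>

lemma point_right_ideal_eq:
  fixes F :: "('k :: field, 'x :: finite) nc_poly set"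
  assumes F: "\<forall>f \<in> F. nc_eval (affine_coord p) f = 0"
  shows "point_right_ideal F p =
    {X \<in> carrier (presented_algebra F). algebra_character (affine_coord p) X = 0}"
    (is "_ = ?I")
proof -
  let ?A = "presented_algebra F"
  let ?x = "\<lambda>i. nc_var i - Poly_Mapping.single [] (affine_coord p i)"
  have fs: "finsum ?A (\<lambda>i. nc_class F (?x i) \<otimes>\<^bsub>?A\<^esub> nc_class F (b i)) UNIV
      = nc_class F (\<Sum>i \<in> UNIV. ?x i * b i)" for b
    by (simp add: nc_class_mult nc_class_finsum)
  have "X \<in> ?I" if "X \<in> point_right_ideal F p" for X
  proof -
    obtain a where X: "X = finsum ?A (\<lambda>i. nc_class F (?x i) \<otimes>\<^bsub>?A\<^esub> a i) UNIV"
      and a: "\<forall>i. a i \<in> range (nc_class F)"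
      using \<open>X \<in> point_right_ideal F p\<close> by (auto simp: point_right_ideal_def Let_def carrier_presented)
    obtain b where "\<forall>i. a i = nc_class F (b i)"
      using a choice[of "\<lambda>i f. a i = nc_class F f"] by blast
    then have "a = (\<lambda>i. nc_class F (b i))" by blast
    then show ?thesis
      using fs[of b] X by (simp add: algebra_character_nc_class[OF F] carrier_presented)
  qed
  moreover have "X \<in> point_right_ideal F p" if X_in: "X \<in> ?I" for X
  proof -
    obtain f where X: "X = nc_class F f"
      using X_in by (auto simp: carrier_presented)
    then have f: "nc_eval (affine_coord p) f = 0"
      using X_in by (simp add: algebra_character_nc_class[OF F])
    obtain b where "f = Poly_Mapping.single [] (nc_eval (affine_coord p) f) + (\<Sum>i \<in> UNIV. ?x i * b i)"
      using nc_eval_decompose by (rule exE)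
    then have "f = (\<Sum>i \<in> UNIV. ?x i * b i)"
      by (simp only: f single_zero add_0)
    then have "X = finsum ?A (\<lambda>i. nc_class F (?x i) \<otimes>\<^bsub>?A\<^esub> nc_class F (b i)) UNIV"
      using X fs by simp
    then show ?thesis
      unfolding point_right_ideal_def Let_def
      by (intro CollectI exI[of _ "\<lambda>i. nc_class F (b i)"]) (simp add: carrier_presented)
  qed
  ultimately show ?thesis by blast
qed

text \<open>When the relations vanish at \<open>v\<close>, these are the cosets of the kernel of the
  character, indexed by their value. The description by representatives turns coset operations into
  operations on polynomials.\<close>

definition character_fiber :: "('k :: field, 'x) nc_poly set \<Rightarrow> ('x \<Rightarrow> 'k) \<Rightarrow> 'k \<Rightarrow> ('k, 'x) nc_poly set set"
  where "character_fiber F v t = nc_class F ` {f. nc_eval v f = t}"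

lemma character_fiber_eq:
  assumes "\<forall>f \<in> F. nc_eval v f = 0"
  shows "character_fiber F v t = {X \<in> carrier (presented_algebra F). algebra_character v X = t}"
  by (auto simp: character_fiber_def carrier_presented algebra_character_nc_class[OF assms])

text \<open>The fiber over s contains the class of the constant s, and the value there recovers
  s.\<close>

lemma character_fiber_inj:
  assumes "\<forall>f \<in> F. nc_eval v f = 0"
  shows "inj (character_fiber F v)"
proof
  fix s t assume eq: "character_fiber F v s = character_fiber F v t"
  have "nc_class F (Poly_Mapping.single [] s) \<in> character_fiber F v s"
    by (auto simp: character_fiber_def)
  then show "s = t"
    unfolding eq by (simp add: character_fiber_eq[OF assms] algebra_character_nc_class[OF assms])
qed

section \<open>The point module as K with A acting through a character\<close>

context
  fixes F :: "('k :: field, 'x :: finite) nc_poly set" and p :: "('k, 'x option) proj_point"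
  assumes F: "\<forall>f \<in> F. nc_eval (affine_coord p) f = 0"
begin

lemma point_right_ideal_fiber:
  "point_right_ideal F p = character_fiber F (affine_coord p) 0"
  by (simp add: point_right_ideal_eq[OF F] character_fiber_eq[OF F])

lemma point_right_ideal_coset:
  "point_right_ideal F p +>\<^bsub>right_regular (presented_algebra F)\<^esub> nc_class F f =
    character_fiber F (affine_coord p) (nc_eval (affine_coord p) f)"
proof -
  \<comment> \<open>If g and f have equal values, then g - f has value zero, so g is a translate by
    f of an element of the kernel.\<close>
  have "nc_class F g \<in> (\<lambda>h. nc_class F (h + f)) ` {h. nc_eval (affine_coord p) h = 0}"
    if "nc_eval (affine_coord p) g = nc_eval (affine_coord p) f" for g
    using that by (intro image_eqI[of _ _ "g - f"]) auto
  then show ?thesis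
    by (auto simp: a_r_coset_def r_coset_def right_regular_def point_right_ideal_fiber
        character_fiber_def nc_class_add)
qed

lemma carrier_point_module:
  "carrier (point_module F p) = range (character_fiber F (affine_coord p))"
proof -
  have "carrier (point_module F p) =
      range (\<lambda>f. point_right_ideal F p +>\<^bsub>right_regular (presented_algebra F)\<^esub> nc_class F f)"
    by (auto simp: point_module_def quotient_module_def A_RCOSETS_def RCOSETS_def a_r_coset_def
        carrier_presented right_regular_def)
  \<comment> \<open>Every scalar is the value of some polynomial, so indexing by polynomials can be
    replaced by indexing by values.\<close>
  also have "\<dots> = range (character_fiber F (affine_coord p))"
    unfolding point_right_ideal_coset by (metis nc_eval_surj image_image)
  finally show ?thesis .
qed

lemma point_module_add:
  "character_fiber F (affine_coord p) s \<oplus>\<^bsub>point_module F p\<^esub> character_fiber F (affine_coord p) t =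
    character_fiber F (affine_coord p) (s + t)"
proof -
  \<comment> \<open>Splitting off the constant s shows that the sum of two fibers fills the whole
    fiber over s + t.\<close>
  have "\<exists>f g. h = f + g \<and> nc_eval (affine_coord p) f = s \<and> nc_eval (affine_coord p) g = t"
    if "nc_eval (affine_coord p) h = s + t" for h
    using that by (intro exI[of _ "Poly_Mapping.single [] s"] exI[of _ "h - Poly_Mapping.single [] s"]) simp
  then show ?thesis
    by (fastforce simp: point_module_def quotient_module_def set_add_def set_mult_def
        right_regular_def character_fiber_def nc_class_add)
qed

lemma point_module_smult:
  assumes "r \<in> carrier (presented_algebra F)"
  shows "r \<odot>\<^bsub>point_module F p\<^esub> character_fiber F (affine_coord p) t =
    character_fiber F (affine_coord p) (algebra_character (affine_coord p) r * t)"
proof -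
  obtain g where r: "r = nc_class F g" using assms by (auto simp: carrier_presented)
  \<comment> \<open>The union over the fiber below has equal members; it also has to be
    nonempty.\<close>
  have ne: "\<exists>f. nc_eval (affine_coord p) f = t"
    using nc_eval_surj by (metis surjD)
  have "r \<odot>\<^bsub>point_module F p\<^esub> character_fiber F (affine_coord p) t =
    (\<Union>x \<in> character_fiber F (affine_coord p) t.
      point_right_ideal F p +>\<^bsub>right_regular (presented_algebra F)\<^esub> (x \<otimes>\<^bsub>presented_algebra F\<^esub> r))"
    by (simp add: point_module_def quotient_module_def) (simp add: right_regular_def)
  also have "\<dots> = (\<Union>f \<in> {f. nc_eval (affine_coord p) f = t}.
      character_fiber F (affine_coord p) (nc_eval (affine_coord p) g * t))"
    by (simp add: character_fiber_def[of F "affine_coord p" t] r nc_class_mult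
        point_right_ideal_coset mult.commute)
  finally show ?thesis
    using ne by (auto simp: r algebra_character_nc_class[OF F])
qed

text \<open>Composition with the bijection \<open>character_fiber\<close> from K onto the carrier
  turns an isomorphism into a scalar coordinate \<open>g\<close> on \<open>M\<close>, so cosets no
  longer appear on the right.\<close>

lemma module_isomorphic_point_module_iff:
  "module_isomorphic (presented_algebra F) M (point_module F p) \<longleftrightarrow>
    (\<exists>g. bij_betw g (carrier M) UNIV \<and>
      (\<forall>x \<in> carrier M. \<forall>y \<in> carrier M. g (x \<oplus>\<^bsub>M\<^esub> y) = g x + g y) \<and>
      (\<forall>r \<in> carrier (presented_algebra F). \<forall>x \<in> carrier M.
        g (r \<odot>\<^bsub>M\<^esub> x) = algebra_character (affine_coord p) r * g x))"
    (is "?L \<longleftrightarrow> ?R")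
proof
  let ?\<Phi> = "character_fiber F (affine_coord p)"
  have bij: "bij_betw ?\<Phi> UNIV (carrier (point_module F p))"
    by (simp add: bij_betw_def carrier_point_module character_fiber_inj[OF F])
  note inj = character_fiber_inj[OF F]
  show ?R if L: ?L
  proof -
    obtain h where h: "h \<in> LinearCombinations.module_hom (presented_algebra F) M (point_module F p)"
      and hb: "bij_betw h (carrier M) (carrier (point_module F p))"
      using L by (auto simp: module_isomorphic_def)
    define g where "g = inv_into UNIV ?\<Phi> \<circ> h"
    have gb: "bij_betw g (carrier M) UNIV"
      unfolding g_def using hb bij_betw_inv_into[OF bij] by (rule bij_betw_trans)
    have hg: "h x = ?\<Phi> (g x)" if "x \<in> carrier M" for x
      using that hb unfolding g_def comp_def
      by (metis bij_betwE carrier_point_module f_inv_into_f)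
    have gI: "g x = t" if "h x = ?\<Phi> t" for x t
      using that inj by (simp add: g_def)
    show ?R
      using gb h hg
      by (intro exI[of _ g] conjI ballI gI)
        (auto simp: LinearCombinations.module_hom_def point_module_add point_module_smult)
  qed
  show ?L if R: ?R
  proof -
    obtain g where g: "bij_betw g (carrier M) UNIV \<and>
        (\<forall>x \<in> carrier M. \<forall>y \<in> carrier M. g (x \<oplus>\<^bsub>M\<^esub> y) = g x + g y) \<and>
        (\<forall>r \<in> carrier (presented_algebra F). \<forall>x \<in> carrier M.
          g (r \<odot>\<^bsub>M\<^esub> x) = algebra_character (affine_coord p) r * g x)"
      using R by (rule exE)
    show ?L
      unfolding module_isomorphic_def
      using g bij_betw_trans[OF conjunct1[OF g] bij]
      by (intro bexI[of _ "?\<Phi> \<circ> g"])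
        (auto simp: LinearCombinations.module_hom_def carrier_point_module point_module_add point_module_smult)
  qed
qed

end


section \<open>One-dimensional modules\<close>

lemma right_module_presented_vectorspace:
  fixes F :: "('k :: field, 'x) nc_poly set"
  assumes "right_module (presented_algebra F) M"
  shows "vectorspace class_ring (restrict_scalars (presented_algebra F) M)"
proof -
  interpret right_module "presented_algebra F" M by fact
  have sc: "nc_class F (Poly_Mapping.single [] c) \<in> carrier (presented_algebra F)" for c
    by (simp add: carrier_presented)
  have "Module.module (class_ring :: 'k ring) (restrict_scalars (presented_algebra F) M)"
  proof (rule moduleI)
    show "cring (class_ring :: 'k ring)" by (rule class_cring.cring_axioms)
    show "abelian_group (restrict_scalars (presented_algebra F) M)"
    proof (rule abelian_groupI)
      fix x assume "x \<in> carrier (restrict_scalars (presented_algebra F) M)"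
      then show "\<exists>y\<in>carrier (restrict_scalars (presented_algebra F) M).
          y \<oplus>\<^bsub>restrict_scalars (presented_algebra F) M\<^esub> x = \<zero>\<^bsub>restrict_scalars (presented_algebra F) M\<^esub>"
        using M.l_neg[of x] by (auto simp: restrict_scalars_def)
    qed (auto simp: restrict_scalars_def M.a_ac)
  next
    fix a b :: 'k and x assume "x \<in> carrier (restrict_scalars (presented_algebra F) M)"
    then have x: "x \<in> carrier M" by (simp add: restrict_scalars_def)
    let ?c = "\<lambda>c. nc_class F (Poly_Mapping.single [] c)"
    \<comment> \<open>The right action reverses products. Constants commute, so the factors may be
      swapped and a left vector space results.\<close>
    have "?c (a * b) = ?c b \<otimes>\<^bsub>presented_algebra F\<^esub> ?c a"
      by (simp add: nc_class_mult mult_single plus_list_def mult.commute)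
    then show "(a \<otimes>\<^bsub>class_ring\<^esub> b) \<odot>\<^bsub>restrict_scalars (presented_algebra F) M\<^esub> x =
        a \<odot>\<^bsub>restrict_scalars (presented_algebra F) M\<^esub> (b \<odot>\<^bsub>restrict_scalars (presented_algebra F) M\<^esub> x)"
      using x by (simp add: restrict_scalars_def smult_one_presented rsmult_assoc sc)
    have "?c (a + b) = ?c a \<oplus>\<^bsub>presented_algebra F\<^esub> ?c b"
      by (simp add: nc_class_add single_add)
    then show "(a \<oplus>\<^bsub>class_ring\<^esub> b) \<odot>\<^bsub>restrict_scalars (presented_algebra F) M\<^esub> x =
        a \<odot>\<^bsub>restrict_scalars (presented_algebra F) M\<^esub> x
          \<oplus>\<^bsub>restrict_scalars (presented_algebra F) M\<^esub> b \<odot>\<^bsub>restrict_scalars (presented_algebra F) M\<^esub> x"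
      using x by (simp add: restrict_scalars_def smult_one_presented rsmult_l_distr sc)
    have "?c 1 = \<one>\<^bsub>presented_algebra F\<^esub>"
      by (simp add: one_presented single_Nil_one)
    then show "\<one>\<^bsub>class_ring\<^esub> \<odot>\<^bsub>restrict_scalars (presented_algebra F) M\<^esub> x = x"
      using x by (simp add: restrict_scalars_def smult_one_presented rsmult_one)
  qed (auto simp: restrict_scalars_def smult_one_presented rsmult_r_distr rsmult_closed sc)
  then show ?thesis by (intro vectorspace.intro class_field)
qed

text \<open>A basis is a single nonzero vector. Only the action of constants on \<open>M\<close>
  remains on the right, which frees later arguments from the vector space structure.\<close>

lemma one_dimensional_iff:
  fixes F :: "('k :: field, 'x) nc_poly set"
  assumes "right_module (presented_algebra F) M"
  shows "one_dimensional (presented_algebra F) M \<longleftrightarrow>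
    (\<exists>m \<in> carrier M. m \<noteq> \<zero>\<^bsub>M\<^esub> \<and>
      (\<forall>x \<in> carrier M. \<exists>c. x = nc_class F (Poly_Mapping.single [] c) \<odot>\<^bsub>M\<^esub> m))"
    (is "_ \<longleftrightarrow> ?R")
proof -
  let ?V = "restrict_scalars (presented_algebra F) M"
  interpret V: vectorspace "class_ring :: 'k ring" ?V
    by (rule right_module_presented_vectorspace[OF assms])
  have simps: "carrier ?V = carrier M" "\<zero>\<^bsub>?V\<^esub> = \<zero>\<^bsub>M\<^esub>"
    "\<And>c x. c \<odot>\<^bsub>?V\<^esub> x = nc_class F (Poly_Mapping.single [] c) \<odot>\<^bsub>M\<^esub> x"
    by (simp_all add: restrict_scalars_def smult_one_presented)
  have span: "V.span {m} = (\<lambda>c. nc_class F (Poly_Mapping.single [] c) \<odot>\<^bsub>M\<^esub> m) ` UNIV"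
    if "m \<in> carrier M" for m
  proof -
    have "m \<in> carrier ?V" using that by (simp add: simps)
    then have "V.lincomb a {m} = a m \<odot>\<^bsub>?V\<^esub> m" for a
      by (simp add: V.lincomb_def)
    moreover have "V.span {m} = {V.lincomb a {m} | a. a \<in> {m} \<rightarrow> UNIV}"
      using V.finite_span[of "{m}"] that by (simp add: simps)
    ultimately show ?thesis by (auto simp: simps intro: exI[of _ "\<lambda>_. _"])
  qed
  have gen: "V.gen_set {m} \<longleftrightarrow> (\<forall>x \<in> carrier M. \<exists>c. x = nc_class F (Poly_Mapping.single [] c) \<odot>\<^bsub>M\<^esub> m)"
    if "m \<in> carrier M" for m
    using that V.span_is_subset2[of "{m}"] unfolding span[OF that] simps by auto
  show ?thesis
  proof
    assume "one_dimensional (presented_algebra F) M"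
    then have fd: "V.fin_dim" and dim: "V.dim = 1" by (simp_all add: one_dimensional_def)
    obtain \<beta> where \<beta>: "finite \<beta>" "V.basis \<beta>" using V.finite_basis_exists[OF fd] by blast
    then have "card \<beta> = 1" using V.dim_basis dim by simp
    then obtain m where m: "\<beta> = {m}" by (auto simp: card_1_singleton_iff)
    \<comment> \<open>A linearly independent set does not contain zero.\<close>
    have "m \<noteq> \<zero>\<^bsub>?V\<^esub>" "m \<in> carrier M" "V.gen_set {m}"
      using \<beta>(2) V.vs_zero_lin_dep[of "{m}"] by (auto simp: V.basis_def m simps)
    then show ?R using gen by (auto simp: simps)
  next
    assume ?R
    then obtain m where m: "m \<in> carrier M" "m \<noteq> \<zero>\<^bsub>M\<^esub>" "V.gen_set {m}"
      using gen by blast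
    then have "V.dim = 1" by (intro V.dim1I) (auto simp: simps)
    moreover have "V.fin_dim" unfolding V.fin_dim_def using m by (intro exI[of _ "{m}"]) (auto simp: simps)
    ultimately show "one_dimensional (presented_algebra F) M" by (simp add: one_dimensional_def)
  qed
qed

lemma one_dimensional_point_module:
  fixes F :: "('k :: field, 'x :: finite) nc_poly set"
  assumes M: "right_module (presented_algebra F) M"
    and F: "\<forall>f \<in> F. nc_eval (affine_coord p) f = 0"
    and iso: "module_isomorphic (presented_algebra F) M (point_module F p)"
  shows "one_dimensional (presented_algebra F) M"
proof -
  interpret right_module "presented_algebra F" M by fact
  obtain g where gb: "bij_betw g (carrier M) UNIV"
    and add: "\<And>x y. x \<in> carrier M \<Longrightarrow> y \<in> carrier M \<Longrightarrow> g (x \<oplus>\<^bsub>M\<^esub> y) = g x + g y"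
    and act: "\<And>r x. r \<in> carrier (presented_algebra F) \<Longrightarrow> x \<in> carrier M \<Longrightarrow>
        g (r \<odot>\<^bsub>M\<^esub> x) = algebra_character (affine_coord p) r * g x"
    using iso unfolding module_isomorphic_point_module_iff[OF F] by blast
  \<comment> \<open>The vector of coordinate 1 spans: x and its multiple \<open>g x\<close> of m
    have the same coordinate.\<close>
  obtain m where m: "m \<in> carrier M" "g m = 1"
    using gb by (metis UNIV_I bij_betw_iff_bijections)
  have "g \<zero>\<^bsub>M\<^esub> = 0"
    using add[OF M.zero_closed M.zero_closed] by (metis M.zero_closed M.l_zero add_cancel_right_right)
  then have "m \<noteq> \<zero>\<^bsub>M\<^esub>" using m by auto
  moreover have "x = nc_class F (Poly_Mapping.single [] (g x)) \<odot>\<^bsub>M\<^esub> m" if "x \<in> carrier M" for x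
  proof (rule inj_onD[OF bij_betw_imp_inj_on[OF gb]])
    show "g x = g (nc_class F (Poly_Mapping.single [] (g x)) \<odot>\<^bsub>M\<^esub> m)"
      using m by (simp add: act carrier_presented algebra_character_nc_class[OF F])
  qed (use that m in \<open>auto simp: carrier_presented intro: rsmult_closed\<close>)
  ultimately show ?thesis
    unfolding one_dimensional_iff[OF M] using m(1) by blast
qed

text \<open>A nonzero vector m identifies K with \<open>M\<close>. The scalar \<open>v i\<close> by
  which x_i acts on m defines the point, and induction on words shows that f acts on m as
  \<open>nc_eval v f\<close>. Relations act as zero, so they vanish at \<open>v\<close>.\<close>

lemma one_dimensional_character:
  fixes F :: "('k :: field, 'x) nc_poly set"
  assumes M: "right_module (presented_algebra F) M"
    and dim: "one_dimensional (presented_algebra F) M"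
  obtains v g where "\<forall>f \<in> F. nc_eval v f = 0"
    and "bij_betw g (carrier M) UNIV"
    and "\<forall>x \<in> carrier M. \<forall>y \<in> carrier M. g (x \<oplus>\<^bsub>M\<^esub> y) = g x + g y"
    and "\<forall>r \<in> carrier (presented_algebra F). \<forall>x \<in> carrier M.
      g (r \<odot>\<^bsub>M\<^esub> x) = algebra_character v r * g x"
proof -
  let ?A = "presented_algebra F"
  interpret right_module ?A M by fact
  obtain m where m: "m \<in> carrier M" "m \<noteq> \<zero>\<^bsub>M\<^esub>"
    and gen: "\<forall>x \<in> carrier M. \<exists>c. x = nc_class F (Poly_Mapping.single [] c) \<odot>\<^bsub>M\<^esub> m"
    using dim unfolding one_dimensional_iff[OF M] by blast
  define line where "line c = nc_class F (Poly_Mapping.single [] c) \<odot>\<^bsub>M\<^esub> m" for c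
  have cl: "nc_class F f \<in> carrier ?A" for f by (simp add: carrier_presented)
  have nc_mult: "nc_class F (f * h) \<odot>\<^bsub>M\<^esub> x = nc_class F h \<odot>\<^bsub>M\<^esub> (nc_class F f \<odot>\<^bsub>M\<^esub> x)"
    and nc_add: "nc_class F (f + h) \<odot>\<^bsub>M\<^esub> x = nc_class F f \<odot>\<^bsub>M\<^esub> x \<oplus>\<^bsub>M\<^esub> nc_class F h \<odot>\<^bsub>M\<^esub> x"
    if "x \<in> carrier M" for f h x
    using that by (simp_all add: rsmult_assoc rsmult_l_distr cl flip: nc_class_mult nc_class_add)
  have nc_one: "nc_class F 1 \<odot>\<^bsub>M\<^esub> x = x" if "x \<in> carrier M" for x
    using that by (simp add: rsmult_one flip: one_presented)
  have line_closed: "line c \<in> carrier M" for c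
    using m by (simp add: line_def rsmult_closed cl)
  have line_add: "line (c + d) = line c \<oplus>\<^bsub>M\<^esub> line d" for c d
    using m by (simp add: line_def single_add nc_add)
  have line_mult: "nc_class F (Poly_Mapping.single [] c) \<odot>\<^bsub>M\<^esub> line d = line (c * d)" for c d
    using m by (simp add: line_def mult_single plus_list_def mult.commute flip: nc_mult)
  have line_0: "line 0 = \<zero>\<^bsub>M\<^esub>"
    using line_add[of 0 0] line_closed[of 0] by simp
  have smult_zero: "nc_class F (Poly_Mapping.single [] c) \<odot>\<^bsub>M\<^esub> \<zero>\<^bsub>M\<^esub> = \<zero>\<^bsub>M\<^esub>" for c
    using line_mult[of c 0] by (simp add: line_0)
  have line_zero_iff: "line c = \<zero>\<^bsub>M\<^esub> \<longleftrightarrow> c = 0" for c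
  proof
    assume c: "line c = \<zero>\<^bsub>M\<^esub>"
    show "c = 0"
    proof (rule ccontr)
      assume "c \<noteq> 0"
      \<comment> \<open>Multiplication by the inverse of c carries m c to m.\<close>
      then have "line 1 = \<zero>\<^bsub>M\<^esub>"
        using line_mult[of "inverse c" c] by (simp add: c smult_zero)
      then show False using m by (simp add: line_def single_Nil_one nc_one)
    qed
  qed (simp add: line_0)
  have "inj line"
  proof
    fix c d assume eq: "line c = line d"
    have "line (c - d) \<oplus>\<^bsub>M\<^esub> line d = \<zero>\<^bsub>M\<^esub> \<oplus>\<^bsub>M\<^esub> line d"
      using line_closed eq by (simp flip: line_add)
    then have "line (c - d) = \<zero>\<^bsub>M\<^esub>"
      using line_closed by (metis M.add.right_cancel M.zero_closed)
    then show "c = d" by (simp add: line_zero_iff)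
  qed
  then have bij: "bij_betw line UNIV (carrier M)"
    using gen line_closed by (auto simp: bij_betw_def line_def)
  define v where "v i = inv_into UNIV line (nc_class F (nc_var i) \<odot>\<^bsub>M\<^esub> m)" for i
  have v: "nc_class F (nc_var i) \<odot>\<^bsub>M\<^esub> m = line (v i)" for i
    unfolding v_def using bij m rsmult_closed[OF cl]
    by (metis bij_betw_imp_surj_on f_inv_into_f)
  have single: "nc_class F (Poly_Mapping.single w t) \<odot>\<^bsub>M\<^esub> m = line (t * prod_list (map v w))" for w t
  proof (induction w arbitrary: t)
    case Nil
    show ?case by (simp add: line_def)
  next
    case (Cons i w)
    \<comment> \<open>In a right module the first letter acts first. It yields the scalar
      \<open>v i\<close>, which is then absorbed into the coefficient.\<close>
    have "Poly_Mapping.single (i # w) t = nc_var i * Poly_Mapping.single w t"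
      by (simp add: nc_var_def mult_single plus_list_def)
    then have "nc_class F (Poly_Mapping.single (i # w) t) \<odot>\<^bsub>M\<^esub> m =
        nc_class F (Poly_Mapping.single w t) \<odot>\<^bsub>M\<^esub> line (v i)"
      using m by (simp add: nc_mult v)
    also have "\<dots> = nc_class F (Poly_Mapping.single w (v i * t)) \<odot>\<^bsub>M\<^esub> m"
      using m by (simp add: line_def mult_single plus_list_def flip: nc_mult)
    finally show ?case by (simp add: Cons.IH mult_ac)
  qed
  have expand: "nc_class F (\<Sum>w \<in> S. Poly_Mapping.single w (Poly_Mapping.lookup f w)) \<odot>\<^bsub>M\<^esub> m =
      line (\<Sum>w \<in> S. Poly_Mapping.lookup f w * prod_list (map v w))" if "finite S" for S f
    using that
  proof (induction S rule: finite_induct)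
    case empty
    show ?case using single[of "[]" 0] by simp
  next
    case (insert w S)
    then show ?case using m by (simp add: nc_add single line_add)
  qed
  have act: "nc_class F f \<odot>\<^bsub>M\<^esub> m = line (nc_eval v f)" for f
    using expand[OF finite_keys[of f], of f] by (simp add: nc_poly_expand nc_eval_def)
  have F: "\<forall>f \<in> F. nc_eval v f = 0"
    using act nc_class_eq_zero line_zero_iff by (metis nc_eval_zero)
  define g where "g = inv_into UNIV line"
  have gb: "bij_betw g (carrier M) UNIV"
    unfolding g_def using bij by (rule bij_betw_inv_into)
  have lg: "line (g x) = x" if "x \<in> carrier M" for x
    unfolding g_def using bij that by (metis bij_betw_imp_surj_on f_inv_into_f)
  have gl: "g (line c) = c" for c
    using \<open>inj line\<close> by (simp add: g_def)
  have "g (x \<oplus>\<^bsub>M\<^esub> y) = g x + g y" if "x \<in> carrier M" "y \<in> carrier M" for x y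
    using that gl[of "g x + g y"] by (simp add: line_add lg)
  moreover have "g (r \<odot>\<^bsub>M\<^esub> x) = algebra_character v r * g x"
    if r: "r \<in> carrier ?A" and x: "x \<in> carrier M" for r x
  proof -
    obtain f where f: "r = nc_class F f" using r by (auto simp: carrier_presented)
    \<comment> \<open>Writing x as m times its coordinate reduces the action on x to the action on
      m.\<close>
    have "r \<odot>\<^bsub>M\<^esub> x = nc_class F (Poly_Mapping.single [] (g x) * f) \<odot>\<^bsub>M\<^esub> m"
      using lg[OF x] m by (simp add: f nc_mult flip: line_def)
    also have "\<dots> = line (nc_eval v f * g x)"
      by (simp add: act mult.commute)
    finally show ?thesis by (simp add: gl f algebra_character_nc_class[OF F])
  qed
  ultimately show ?thesis using that[OF F gb] by blast
qed


section \<open>Affine points of the geometric data\<close>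

lemma proj_class_self: "v \<in> proj_class v"
  by (auto simp: proj_class_def intro: exI[of _ 1])

lemma proj_class_affine: "v None \<noteq> 0 \<Longrightarrow> proj_class v = proj_class (case_option 1 (\<lambda>i. v (Some i) / v None))"
proof -
  assume v: "v None \<noteq> 0"
  let ?w = "case_option 1 (\<lambda>i. v (Some i) / v None)"
  show ?thesis
  proof (intro equalityI subsetI)
    fix u assume "u \<in> proj_class v"
    then obtain c where "c \<noteq> 0" "u = (\<lambda>i. c * v i)" by (auto simp: proj_class_def)
    then show "u \<in> proj_class ?w"
      \<comment> \<open>The two coordinate vectors differ by the factor \<open>v None\<close>, which
        rescales c here and in the converse.\<close>
      unfolding proj_class_def using v
      by (intro CollectI exI[of _ "c * v None"]) (auto simp: fun_eq_iff split: option.split)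
  next
    fix u assume "u \<in> proj_class ?w"
    then obtain c where "c \<noteq> 0" "u = (\<lambda>i. c * ?w i)" by (auto simp: proj_class_def)
    then show "u \<in> proj_class v"
      unfolding proj_class_def using v
      by (intro CollectI exI[of _ "c / v None"]) (auto simp: fun_eq_iff split: option.split)
  qed
qed

text \<open>The condition that the first coordinate be 1 forces the scaling factor to be 1, so the
  normalized vector is unique.\<close>

lemma affine_coord_proj_class: "affine_coord (proj_class (case_option 1 c)) = c"
proof -
  have "(THE v. v \<in> proj_class (case_option 1 c) \<and> v None = 1) = case_option 1 c"
    by (rule the_equality) (auto simp: proj_class_self, auto simp: proj_class_def)
  then show ?thesis by (simp add: affine_coord_def fun_eq_iff)
qed

text \<open>Affine coordinates determine the point; this finally separates distinct points.\<close>

lemma affine_points_normalized: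
  assumes "p \<in> affine_points E"
  shows "p = proj_class (case_option 1 (affine_coord p))"
proof -
  obtain v where v: "p = proj_class v" "v None \<noteq> 0"
    using assms proj_class_self by (fastforce simp: affine_points_def scheme_points_def)
  have p: "p = proj_class (case_option 1 (\<lambda>i. v (Some i) / v None))"
    unfolding v(1) by (rule proj_class_affine[where v = v, OF v(2)])
  then have "affine_coord p = (\<lambda>i. v (Some i) / v None)"
    by (simp add: affine_coord_proj_class)
  then show ?thesis by (simp only: flip: p)
qed

text \<open>With \<open>j\<close> the index of x_0 and a_0 nonzero, vanishing of these values for
  all i makes b proportional to a.\<close>

lemma bilinear_eval_commutator:
  "bilinear_eval (nc_var j * nc_var i - nc_var i * nc_var j) a b = a j * b i - a i * b (j :: 'v :: finite)"
proof -
  have *: "bilinear_eval (Poly_Mapping.single [k, l] 1) a b = a k * b l" for k l :: 'v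
  proof -
    have "(if [k, l] = [i, j] then 1 else 0) * a i * b j = (if j = l then (if i = k then a k * b l else 0) else 0)" for i j
      by auto
    then show ?thesis
      by (simp add: bilinear_eval_def lookup_single when_def)
  qed
  have "bilinear_eval (f - g) a b = bilinear_eval f a b - bilinear_eval g a b" for f g
    by (simp add: bilinear_eval_def lookup_minus left_diff_distrib sum_subtractf)
  then show ?thesis by (simp add: nc_var_def mult_single plus_list_def *)
qed

text \<open>Commutators vanish under evaluation in a field, and homogenization preserves values at
  first coordinate 1.\<close>

lemma nc_eval_homogenization_relations:
  "(\<forall>f \<in> homogenization_relations fs. nc_eval (case_option 1 v) f = 0) \<longleftrightarrow> (\<forall>f \<in> set fs. nc_eval v f = 0)"
proof -
  have "(\<forall>f \<in> homogenization_relations fs. P f) \<longleftrightarrow> (\<forall>f \<in> set fs. P (homogenize f)) \<and>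
      (\<forall>i. P (nc_var None * nc_var (Some i) - nc_var (Some i) * nc_var None))" for P
    unfolding homogenization_relations_def by blast
  then show ?thesis by (simp add: nc_eval_homogenize mult.commute)
qed

text \<open>Centrality of x_0 forces \<sigma>(p) = p, so the quadratic relations vanish at (p, p);
  that is, evaluation at p kills the relations of H(A), and hence those of A.\<close>

lemma geometric_affine_point:
  fixes fs :: "('k :: field, 'x :: finite) nc_poly list"
  assumes geo: "geometric (homogenization_relations fs) E \<sigma>" and p: "p \<in> affine_points E"
  shows "\<forall>f \<in> set fs. nc_eval (affine_coord p) f = 0"
proof -
  let ?F = "homogenization_relations fs"
  obtain R where R: "R \<subseteq> nc_homogeneous 2" "relation_ideal R = relation_ideal ?F"
    "zero_locus R = {(p, atlas_map \<sigma> p) | p. p \<in> scheme_points E}"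
    using geo unfolding geometric_def by blast
  let ?v = "case_option 1 (affine_coord p)"
  have "(p, atlas_map \<sigma> p) \<in> zero_locus R"
    using p R(3) by (auto simp: affine_points_def)
  then obtain b where b: "b \<noteq> (\<lambda>_. 0)" "atlas_map \<sigma> p = proj_class b"
    and van: "\<forall>f \<in> R. vanishes_at f p (atlas_map \<sigma> p)"
    by (auto simp: zero_locus_def proj_space_def)
  have "?v \<in> p" using affine_points_normalized[OF p] proj_class_self by metis
  moreover have "b \<in> atlas_map \<sigma> p" unfolding b(2) by (rule proj_class_self)
  ultimately have bil: "\<forall>f \<in> R. bilinear_eval f ?v b = 0"
    using van unfolding vanishes_at_def by blast
  have "b (Some i) = ?v (Some i) * b None" for i
  proof -
    \<comment> \<open>The commutator is obtained only as a member of the ideal generated by R, hence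
      the passage through \<open>bilinear_eval_relation_ideal\<close>.\<close>
    have "nc_var None * nc_var (Some i) - nc_var (Some i) * nc_var None \<in> relation_ideal R"
      using relation_ideal_superset[of ?F] by (auto simp: R(2) homogenization_relations_def)
    from bilinear_eval_relation_ideal[OF R(1) bil this] show ?thesis
      by (simp add: bilinear_eval_commutator)
  qed
  then have bv: "b i = b None * ?v i" for i by (cases i) auto
  \<comment> \<open>Otherwise b would be the zero vector, which represents no projective
    point.\<close>
  have b0: "b None \<noteq> 0"
  proof
    assume "b None = 0"
    then have "b i = 0" for i using bv[of i] by simp
    then show False using b(1) by blast
  qed
  have zero: "\<forall>f \<in> R. nc_eval ?v f = 0"
  proof
    fix f assume f: "f \<in> R"
    \<comment> \<open>Linearity in the second argument, applied to b = b_0 v.\<close>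
    have "0 = bilinear_eval f ?v b" using bil f by simp
    also have "\<dots> = b None * bilinear_eval f ?v ?v"
      unfolding bilinear_eval_def sum_distrib_left
      by (intro sum.cong refl) (subst bv, simp only: mult_ac)
    finally have "bilinear_eval f ?v ?v = 0" using b0 by simp
    then show "nc_eval ?v f = 0" using nc_eval_quadratic[OF subsetD[OF R(1) f]] by simp
  qed
  have "\<forall>f \<in> ?F. nc_eval ?v f = 0"
    using nc_eval_relation_ideal[OF zero, unfolded R(2)] relation_ideal_superset[of ?F] by blast
  then show ?thesis by (simp add: nc_eval_homogenization_relations)
qed

text \<open>Evaluation at (1 : c) kills the relations of H(A), hence R. Thus (p, p) lies in the zero
  locus, which is the graph of \<sigma> over E, and its first component is a point of E.\<close>

lemma geometric_affine_pointI:
  fixes fs :: "('k :: field, 'x :: finite) nc_poly list"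
  assumes geo: "geometric (homogenization_relations fs) E \<sigma>"
    and c: "\<forall>f \<in> set fs. nc_eval c f = 0"
  shows "proj_class (case_option 1 c) \<in> affine_points E"
proof -
  let ?F = "homogenization_relations fs"
  obtain R where R: "R \<subseteq> nc_homogeneous 2" "relation_ideal R = relation_ideal ?F"
    "zero_locus R = {(p, atlas_map \<sigma> p) | p. p \<in> scheme_points E}"
    using geo unfolding geometric_def by blast
  let ?v = "case_option 1 c" and ?p = "proj_class (case_option 1 c)"
  have zero: "bilinear_eval f ?v ?v = 0" if "f \<in> R" for f
  proof -
    have "f \<in> relation_ideal ?F"
      using subsetD[OF relation_ideal_superset that] by (simp only: R(2))
    moreover have "\<forall>f \<in> ?F. nc_eval ?v f = 0"
      using c by (simp only: nc_eval_homogenization_relations)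
    ultimately have "nc_eval ?v f = 0" by (intro nc_eval_relation_ideal[of ?F])
    then show ?thesis using nc_eval_quadratic[OF subsetD[OF R(1) that], of ?v] by simp
  qed
  \<comment> \<open>Vanishing does not depend on the coordinate vectors chosen for the two
    points.\<close>
  have scale: "bilinear_eval f (\<lambda>i. s * ?v i) (\<lambda>i. t * ?v i) = s * t * bilinear_eval f ?v ?v" for f s t
    by (simp add: bilinear_eval_def sum_distrib_left mult_ac)
  have "vanishes_at f ?p ?p" if "f \<in> R" for f
    unfolding vanishes_at_def proj_class_def
    by (intro ballI, elim CollectE exE conjE) (simp only: scale zero[OF that] mult_zero_right)
  moreover have "?p \<in> proj_space"
  proof -
    have "?v \<noteq> (\<lambda>_. 0)" by (metis option.simps(4) zero_neq_one)
    then show ?thesis unfolding proj_space_def by blast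
  qed
  ultimately have "(?p, ?p) \<in> zero_locus R" by (auto simp: zero_locus_def)
  then have "?p \<in> scheme_points E" using R(3) by auto
  moreover have "\<forall>u \<in> ?p. u None \<noteq> 0" by (auto simp: proj_class_def)
  ultimately show ?thesis unfolding affine_points_def by blast
qed

section \<open>Classification by points and separation of the points\<close>

theorem proposition4p6:
  fixes fs :: "('k :: {alg_closed_field, field_char_0}, 'x :: finite) nc_poly list"
    and d :: nat
    and E :: "('k, 'x option) comm_poly set"
    and \<sigma> :: "('k, 'x option) atlas"
  assumes "essentially_regular fs d"
    and "x0_not_zero_divisor fs"
    and "geometric (homogenization_relations fs) E \<sigma>"
  shows "let A = presented_algebra (set fs); Mp = point_module (set fs) in
    (\<forall>M :: (('k, 'x) nc_poly set, 'm) module. right_module A M \<longrightarrow>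
       (one_dimensional A M \<longleftrightarrow> (\<exists>p \<in> affine_points E. module_isomorphic A M (Mp p)))) \<and>
    (\<forall>p \<in> affine_points E. \<forall>q \<in> affine_points E.
       one_dimensional A (Mp p) \<and> right_simple A (Mp p) \<and>
       one_dimensional A (Mp q) \<and> right_simple A (Mp q) \<longrightarrow>
       (module_isomorphic A (Mp p) (Mp q) \<longleftrightarrow> p = q))"
proof -
  let ?F = "set fs" and ?A = "presented_algebra (set fs)"
  note kills = geometric_affine_point[OF assms(3)]
  have point: "\<exists>p \<in> affine_points E. module_isomorphic ?A M (point_module ?F p)"
    if M: "right_module ?A M" and dim: "one_dimensional ?A M"
    for M :: "(('k, 'x) nc_poly set, 'm) module"
  proof -
    obtain v g where v: "\<forall>f \<in> ?F. nc_eval v f = 0"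
      and g: "bij_betw g (carrier M) UNIV"
        "\<forall>x \<in> carrier M. \<forall>y \<in> carrier M. g (x \<oplus>\<^bsub>M\<^esub> y) = g x + g y"
        "\<forall>r \<in> carrier ?A. \<forall>x \<in> carrier M. g (r \<odot>\<^bsub>M\<^esub> x) = algebra_character v r * g x"
      using one_dimensional_character[OF M dim] by blast
    let ?p = "proj_class (case_option 1 v)"
    have p: "affine_coord ?p = v" by (rule affine_coord_proj_class)
    then have "module_isomorphic ?A M (point_module ?F ?p)"
      using v g by (subst module_isomorphic_point_module_iff) auto
    then show ?thesis using geometric_affine_pointI[OF assms(3) v] by blast
  qed
  have distinct: "p = q" if p: "p \<in> affine_points E" and q: "q \<in> affine_points E"
    and iso: "module_isomorphic ?A (point_module ?F p) (point_module ?F q)" for p q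
  proof -
    let ?\<Phi> = "character_fiber ?F (affine_coord p)"
    obtain g where g: "bij_betw g (carrier (point_module ?F p)) UNIV"
      and act: "\<And>r x. r \<in> carrier ?A \<Longrightarrow> x \<in> carrier (point_module ?F p) \<Longrightarrow>
        g (r \<odot>\<^bsub>point_module ?F p\<^esub> x) = algebra_character (affine_coord q) r * g x"
      using iso unfolding module_isomorphic_point_module_iff[OF kills[OF q]] by blast
    \<comment> \<open>An element of coordinate 1: letting f act on it compares the characters at p
      and at q.\<close>
    have "1 \<in> g ` range ?\<Phi>"
      using g unfolding carrier_point_module[OF kills[OF p]] by (simp add: bij_betw_def)
    then obtain t where t: "g (?\<Phi> t) = 1" by auto
    have \<Phi>_in: "?\<Phi> s \<in> carrier (point_module ?F p)" for s
      by (simp add: carrier_point_module[OF kills[OF p]])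
    have eval: "nc_eval (affine_coord q) f = g (?\<Phi> (nc_eval (affine_coord p) f * t))" for f
    proof -
      have f: "nc_class ?F f \<in> carrier ?A" by (simp add: carrier_presented)
      show ?thesis
        using act[OF f \<Phi>_in[of t]]
        by (simp add: t point_module_smult[OF kills[OF p] f] algebra_character_nc_class[OF kills[OF p]]
            algebra_character_nc_class[OF kills[OF q]])
    qed
    \<comment> \<open>The variable x_i and the constant p_i have the same value at p, hence by
      \<open>eval\<close> the same value at q.\<close>
    have "affine_coord q i = affine_coord p i" for i
      using eval[of "nc_var i"] eval[of "Poly_Mapping.single [] (affine_coord p i)"] by simp
    then have "affine_coord q = affine_coord p" by blast
    then show ?thesis
      using affine_points_normalized[OF p] affine_points_normalized[OF q] by simp
  qed
  have iso_refl: "module_isomorphic ?A M M" for M :: "(('k, 'x) nc_poly set, ('k, 'x) nc_poly set set) module"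
    unfolding module_isomorphic_def LinearCombinations.module_hom_def
    by (rule bexI[of _ "\<lambda>x. x"]) (auto simp: bij_betw_def)
  show ?thesis
    unfolding Let_def
  proof (intro conjI allI ballI impI iffI)
    fix M :: "(('k, 'x) nc_poly set, 'm) module"
    assume M: "right_module ?A M"
    assume "\<exists>p \<in> affine_points E. module_isomorphic ?A M (point_module ?F p)"
    then obtain p where "p \<in> affine_points E" "module_isomorphic ?A M (point_module ?F p)" by blast
    then show "one_dimensional ?A M"
      using one_dimensional_point_module[OF M kills] by blast
  qed (simp_all add: point distinct iso_refl)
qed

end
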